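(* Let $(\mathcal{H},[\cdot,\cdot])$ be a Krein space with fundamental symmetry $J$. Given a surjective operator $T\in L(\ell_2(I),\mathcal{H})$, the following conditions are equivalent: 1. There exists a unitary operator $U$ on $\ell_2(I)$ such that $TU$ is the synthesis operator of a $J$-frame for $\mathcal{H}$. 2. There exists $Q\in\mathcal{Q}$ such that $QTT^*(I-Q)^*=0$. 3. There exist closed range operators $T_1,T_2\in L(\ell_2(I),\mathcal{H})$ such that $T=T_1+T_2$, $R(T_1)$ is uniformly $J$-positive, $R(T_2)$ is uniformly $J$-negative and $T_1T_2^*=T_2T_1^*=0$.
   Context: Krein space setting: $(\mathcal{H},[\cdot,\cdot])$ is a complex separable Krein space with a fixed fundamental decomposition $\mathcal{H}=\mathcal{H}_+\dotplus\mathcal{H}_-$ (the summands are $[\cdot,\cdot]$-orthogonal and $(\mathcal{H}_\pm,\pm[\cdot,\cdot])$ are Hilbert spaces). $\langle\cdot,\cdot\rangle$ is the inner product making $\mathcal{H}$ the orthogonal direct sum of these Hilbert spaces, $\|\cdot\|$ its norm, and the fundamental symmetry $J$ (a selfadjoint unitary) satisfies $[x,y]=\langle Jx,y\rangle$. $L(\cdot,\cdot)$ denotes bounded linear operators, $R(\cdot)$, $N(\cdot)$ range and nullspace; $*$ denotes the adjoint with respect to the Hilbert space inner products ($\langle\cdot,\cdot\rangle$ on $\mathcal{H}$ and the usual one on $\ell_2(I)$). A subspace $\mathcal{S}$ is uniformly $J$-positive (resp. uniformly $J$-negative) if there is $\alpha>0$ with $[x,x]\ge\alpha\|x\|^2$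 (resp. $[x,x]\le-\alpha\|x\|^2$) for all $x\in\mathcal{S}$. "Maximal" means maximal with respect to inclusion among such subspaces. $\mathcal{Q}=\{Q\in L(\mathcal{H}): Q^2=Q,\ R(Q)\text{ is uniformly } J\text{-positive and } N(Q)\text{ is uniformly } J\text{-negative}\}$. A Bessel family is a family $\mathcal{F}=\{f_i\}_{i\in I}$ in $\mathcal{H}$ with $\sum_i|\langle f,f_i\rangle|^2\le B\|f\|^2$ for all $f$ and some $B<\infty$. Its synthesis operator is $V\in L(\ell_2(I),\mathcal{H})$, $Ve_i=f_i$, with $\{e_i\}$ the standard orthonormal basis. The Bessel family $\mathcal{F}$ is a $J$-frame for $\mathcal{H}$ if, with $I_+=\{i\in I:[f_i,f_i]\ge0\}$ and $I_-=\{i\in I:[f_i,f_i]<0\}$, the subspace $V(\ell_2(I_+))$ is maximal uniformly $J$-positive and $V(\ell_2(I_-))$ is maximal uniformly $J$-negative in $\mathcal{H}$. *)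

theory Defs
  imports "HOL-Analysis.Analysis"
begin

section \<open>Complex inner product spaces\<close>

text \<open>
  The class extends \<^class>\<open>real_inner\<close>, whose inner product is required to be the real part of
  the complex one. Norm, metric and topology are therefore those of the complex inner
  product, \<open>norm x = sqrt (Re (cinner x x))\<close>. The product \<open>cinner\<close> is linear in its first argument.
\<close>

class complex_inner = real_inner +
  fixes scaleC :: "complex \<Rightarrow> 'a \<Rightarrow> 'a" (infixr "*\<^sub>C" 75)
    and cinner :: "'a \<Rightarrow> 'a \<Rightarrow> complex"
  assumes scaleC_add_right: "a *\<^sub>C (x + y) = a *\<^sub>C x + a *\<^sub>C y"
    and scaleC_add_left: "(a + b) *\<^sub>C x = a *\<^sub>C x + b *\<^sub>C x"
    and scaleC_scaleC: "a *\<^sub>C (b *\<^sub>C x) = (a * b) *\<^sub>C x"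
    and scaleR_scaleC: "scaleR r x = complex_of_real r *\<^sub>C x"
    and cinner_commute: "cinner x y = cnj (cinner y x)"
    and cinner_add_left: "cinner (x + y) z = cinner x z + cinner y z"
    and cinner_scaleC_left: "cinner (a *\<^sub>C x) y = a * cinner x y"
    and inner_eq_Re_cinner: "inner x y = Re (cinner x y)"

class chilbert_space = complex_inner + complete_space

lemma scaleC_one: "1 *\<^sub>C x = (x :: 'a::complex_inner)"
  using scaleR_scaleC[of 1 x] by simp

global_interpretation complex_vector: vector_space "scaleC :: complex \<Rightarrow> 'a \<Rightarrow> 'a::complex_inner"
  defines csubspace = complex_vector.subspace
  by standard (simp_all add: scaleC_add_right scaleC_add_left scaleC_scaleC scaleC_one)

definition bounded_clinear :: "('a::complex_inner \<Rightarrow> 'b::complex_inner) \<Rightarrow> bool" where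
  "bounded_clinear f \<longleftrightarrow> bounded_linear f \<and> (\<forall>c x. f (c *\<^sub>C x) = c *\<^sub>C f x)"

text \<open>Meaningful for bounded operators between Hilbert spaces, where the adjoint exists uniquely.\<close>

definition cadjoint :: "('a::complex_inner \<Rightarrow> 'b::complex_inner) \<Rightarrow> 'b \<Rightarrow> 'a" where
  "cadjoint f = (THE g. \<forall>x y. cinner (f x) y = cinner x (g y))"

definition unitary_operator :: "('a::complex_inner \<Rightarrow> 'a) \<Rightarrow> bool" where
  "unitary_operator U \<longleftrightarrow> bounded_clinear U \<and> cadjoint U \<circ> U = id \<and> U \<circ> cadjoint U = id"

section \<open>The space of square summable families\<close>

text \<open>The index set of the space is the whole type \<open>'i\<close>, of arbitrary cardinality.\<close>

typedef 'i ell2 = "{x :: 'i \<Rightarrow> complex. (\<lambda>i. (cmod (x i))\<^sup>2) summable_on UNIV}"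
  morphisms ell2_coord Abs_ell2
  by (rule exI[of _ "\<lambda>_. 0"]) simp

setup_lifting type_definition_ell2

lemma cmod_mult_cnj_le: "cmod (a * cnj b) \<le> (cmod a)\<^sup>2 + (cmod b)\<^sup>2"
proof -
  have "0 \<le> (cmod a - cmod b)\<^sup>2" by simp
  then have "2 * (cmod a * cmod b) \<le> (cmod a)\<^sup>2 + (cmod b)\<^sup>2"
    by (simp add: power2_diff algebra_simps)
  moreover have "0 \<le> cmod a * cmod b" by simp
  ultimately have "cmod a * cmod b \<le> (cmod a)\<^sup>2 + (cmod b)\<^sup>2" by linarith
  then show ?thesis by (simp add: norm_mult)
qed

lemma ell2_mult_summable:
  assumes "(\<lambda>i. (cmod (x i))\<^sup>2) summable_on UNIV" "(\<lambda>i. (cmod (y i))\<^sup>2) summable_on UNIV"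
  shows "(\<lambda>i. x i * cnj (y i)) summable_on UNIV"
proof (rule abs_summable_summable, rule summable_on_comparison_test)
  show "(\<lambda>i. (cmod (x i))\<^sup>2 + (cmod (y i))\<^sup>2) summable_on UNIV"
    by (rule summable_on_add[OF assms])
qed (auto intro: cmod_mult_cnj_le)

lemma ell2_add_summable:
  assumes "(\<lambda>i. (cmod (x i))\<^sup>2) summable_on UNIV" "(\<lambda>i. (cmod (y i))\<^sup>2) summable_on UNIV"
  shows "(\<lambda>i. (cmod (x i + y i))\<^sup>2) summable_on UNIV"
proof (rule summable_on_comparison_test)
  show "(\<lambda>i. 2 * ((cmod (x i))\<^sup>2 + (cmod (y i))\<^sup>2)) summable_on UNIV"
    by (intro summable_on_cmult_right summable_on_add assms)
  fix i
  have "(cmod (x i + y i))\<^sup>2 \<le> (cmod (x i) + cmod (y i))\<^sup>2"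
    by (intro power_mono norm_triangle_ineq) simp
  also have "\<dots> \<le> 2 * ((cmod (x i))\<^sup>2 + (cmod (y i))\<^sup>2)"
    using sum_squares_bound[of "cmod (x i)" "cmod (y i)"] by (simp add: power2_sum)
  finally show "(cmod (x i + y i))\<^sup>2 \<le> 2 * ((cmod (x i))\<^sup>2 + (cmod (y i))\<^sup>2)" .
qed simp

lemma ell2_scale_summable:
  assumes "(\<lambda>i. (cmod (x i))\<^sup>2) summable_on UNIV"
  shows "(\<lambda>i. (cmod (a * x i))\<^sup>2) summable_on UNIV"
  using summable_on_cmult_right[OF assms, of "(cmod a)\<^sup>2"] by (simp add: norm_mult power_mult_distrib)

instantiation ell2 :: (type) complex_inner
begin

lift_definition zero_ell2 :: "'a ell2" is "\<lambda>_. 0" by simp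

lift_definition plus_ell2 :: "'a ell2 \<Rightarrow> 'a ell2 \<Rightarrow> 'a ell2" is "\<lambda>x y i. x i + y i"
  by (rule ell2_add_summable)

lift_definition uminus_ell2 :: "'a ell2 \<Rightarrow> 'a ell2" is "\<lambda>x i. - x i" by simp

lift_definition minus_ell2 :: "'a ell2 \<Rightarrow> 'a ell2 \<Rightarrow> 'a ell2" is "\<lambda>x y i. x i - y i"
  using ell2_add_summable[where y = "\<lambda>i. - y i" for y] by simp

lift_definition scaleR_ell2 :: "real \<Rightarrow> 'a ell2 \<Rightarrow> 'a ell2" is "\<lambda>r x i. complex_of_real r * x i"
  by (rule ell2_scale_summable)

lift_definition scaleC_ell2 :: "complex \<Rightarrow> 'a ell2 \<Rightarrow> 'a ell2" is "\<lambda>a x i. a * x i"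
  by (rule ell2_scale_summable)

lift_definition cinner_ell2 :: "'a ell2 \<Rightarrow> 'a ell2 \<Rightarrow> complex"
  is "\<lambda>x y. \<Sum>\<^sub>\<infinity>i. x i * cnj (y i)" .

definition inner_ell2 :: "'a ell2 \<Rightarrow> 'a ell2 \<Rightarrow> real" where
  "inner_ell2 x y = Re (cinner x y)"

definition norm_ell2 :: "'a ell2 \<Rightarrow> real" where
  "norm_ell2 x = sqrt (inner x x)"

definition dist_ell2 :: "'a ell2 \<Rightarrow> 'a ell2 \<Rightarrow> real" where
  "dist_ell2 x y = norm (x - y)"

definition sgn_ell2 :: "'a ell2 \<Rightarrow> 'a ell2" where
  "sgn_ell2 x = inverse (norm x) *\<^sub>R x"

definition uniformity_ell2 :: "('a ell2 \<times> 'a ell2) filter" where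
  "uniformity_ell2 = (INF e\<in>{0<..}. principal {(x, y). dist x y < e})"

definition open_ell2 :: "'a ell2 set \<Rightarrow> bool" where
  "open_ell2 U \<longleftrightarrow> (\<forall>x\<in>U. \<forall>\<^sub>F (x', y) in uniformity. x' = x \<longrightarrow> y \<in> U)"

instance
proof
  fix x y z :: "'a ell2" and r s :: real and a b :: complex
  show "x + y + z = x + (y + z)" "x + y = y + x" "0 + x = x" "- x + x = 0" "x - y = x + - y"
    by (transfer; simp add: algebra_simps)+
  show "r *\<^sub>R (x + y) = r *\<^sub>R x + r *\<^sub>R y" "(r + s) *\<^sub>R x = r *\<^sub>R x + s *\<^sub>R x"
    "r *\<^sub>R s *\<^sub>R x = (r * s) *\<^sub>R x" "1 *\<^sub>R x = x"
    by (transfer; simp add: algebra_simps)+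
  show "a *\<^sub>C (x + y) = a *\<^sub>C x + a *\<^sub>C y" "(a + b) *\<^sub>C x = a *\<^sub>C x + b *\<^sub>C x"
    "a *\<^sub>C b *\<^sub>C x = (a * b) *\<^sub>C x" "r *\<^sub>R x = complex_of_real r *\<^sub>C x"
    by (transfer; simp add: algebra_simps)+
  show comm: "cinner x y = cnj (cinner y x)" for x y :: "'a ell2"
    by transfer (simp add: infsum_cnj[symmetric] mult.commute)
  show add: "cinner (x + y) z = cinner x z + cinner y z" for x y z :: "'a ell2"
    by transfer (simp add: distrib_right infsum_add ell2_mult_summable)
  show scale: "cinner (a *\<^sub>C x) y = a * cinner x y" for a and x y :: "'a ell2"
    by transfer (simp add: mult.assoc infsum_cmult_right')
  show "inner x y = Re (cinner x y)" by (rule inner_ell2_def)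
  show "inner x y = inner y x"
    using comm[of x y] by (simp add: inner_ell2_def)
  show "inner (x + y) z = inner x z + inner y z"
    by (simp add: inner_ell2_def add)
  have sR: "r *\<^sub>R x = complex_of_real r *\<^sub>C x" by transfer simp
  show "inner (r *\<^sub>R x) y = r * inner x y"
    by (simp add: inner_ell2_def sR scale)
  have sq: "inner x x = (\<Sum>\<^sub>\<infinity>i. (cmod (ell2_coord x i))\<^sup>2)"
    unfolding inner_ell2_def
  proof transfer
    fix x :: "'a \<Rightarrow> complex"
    assume "(\<lambda>i. (cmod (x i))\<^sup>2) summable_on UNIV"
    then have "(\<lambda>i. x i * cnj (x i)) summable_on UNIV" by (intro ell2_mult_summable)
    then show "Re (\<Sum>\<^sub>\<infinity>i. x i * cnj (x i)) = (\<Sum>\<^sub>\<infinity>i. (cmod (x i))\<^sup>2)"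
      by (simp add: infsum_Re[symmetric] complex_mult_cnj cmod_power2)
  qed
  show "0 \<le> inner x x" unfolding sq by (rule infsum_nonneg) simp
  show "inner x x = 0 \<longleftrightarrow> x = 0"
  proof
    assume "inner x x = 0"
    then have "(cmod (ell2_coord x i))\<^sup>2 = 0" for i
      using ell2_coord[of x]
      by (intro nonneg_infsum_le_0D[where f = "\<lambda>i. (cmod (ell2_coord x i))\<^sup>2" and A = UNIV])
        (auto simp: sq)
    then show "x = 0" by transfer auto
  next
    assume "x = 0"
    then show "inner x x = 0" unfolding sq by (simp add: zero_ell2.rep_eq)
  qed
qed (rule norm_ell2_def dist_ell2_def sgn_ell2_def uniformity_ell2_def open_ell2_def)+

end

lift_definition ell2_basis :: "'i \<Rightarrow> 'i ell2" is "\<lambda>i j. if j = i then 1 else 0"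
proof -
  fix i :: 'i
  show "(\<lambda>j. (cmod (if j = i then 1 else 0))\<^sup>2) summable_on UNIV"
    by (rule summable_on_cong_neutral[THEN iffD1, OF _ _ _ summable_on_finite[of "{i}"]]) auto
qed

text \<open>\<open>ell2_on A\<close> is the copy of \<open>\<ell>\<^sub>2(A)\<close> inside \<open>\<ell>\<^sub>2(I)\<close>.\<close>

definition ell2_on :: "'i set \<Rightarrow> 'i ell2 set" where
  "ell2_on A = {x. \<forall>i. i \<notin> A \<longrightarrow> ell2_coord x i = 0}"

section \<open>Krein spaces with a fixed fundamental decomposition\<close>

text \<open>
  \<open>ip\<close> is the indefinite form \<open>[\<cdot>,\<cdot>]\<close>, and \<open>Hp\<close>, \<open>Hm\<close> are the summands of the fundamental
  decomposition. The last three assumptions say that \<open>cinner\<close> makes the space the orthogonal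
  direct sum of \<open>(Hp, ip)\<close> and \<open>(Hm, -ip)\<close>. Hence on \<open>Hp\<close> and \<open>Hm\<close> the norm of the type is
  the one induced by \<open>\<plusminus>ip\<close>, so \<open>complete Hp\<close> and \<open>complete Hm\<close> are completeness with
  respect to \<open>\<plusminus>ip\<close>; definiteness of \<open>\<plusminus>ip\<close> on them likewise comes from that of \<open>cinner\<close>.
\<close>

locale krein_space =
  fixes ip :: "'a::chilbert_space \<Rightarrow> 'a \<Rightarrow> complex"
    and Hp Hm :: "'a set"
  assumes ip_add_left: "ip (x + y) z = ip x z + ip y z"
    and ip_scaleC_left: "ip (a *\<^sub>C x) y = a * ip x y"
    and ip_commute: "ip x y = cnj (ip y x)"
    and separable: "separable_space (euclidean :: 'a topology)"
    and subspace_Hp: "csubspace Hp"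
    and subspace_Hm: "csubspace Hm"
    and Hp_Int_Hm: "Hp \<inter> Hm = {0}"
    and Hp_plus_Hm: "\<exists>p\<in>Hp. \<exists>m\<in>Hm. x = p + m"
    and ip_orthogonal: "p \<in> Hp \<Longrightarrow> m \<in> Hm \<Longrightarrow> ip p m = 0"
    and complete_Hp: "complete Hp"
    and complete_Hm: "complete Hm"
    and cinner_Hp: "p \<in> Hp \<Longrightarrow> p' \<in> Hp \<Longrightarrow> cinner p p' = ip p p'"
    and cinner_Hm: "m \<in> Hm \<Longrightarrow> m' \<in> Hm \<Longrightarrow> cinner m m' = - ip m m'"
    and cinner_orthogonal: "p \<in> Hp \<Longrightarrow> m \<in> Hm \<Longrightarrow> cinner p m = 0"

definition fundamental_symmetry :: "'a::complex_inner set \<Rightarrow> 'a set \<Rightarrow> 'a \<Rightarrow> 'a" where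
  "fundamental_symmetry Hp Hm x = (THE y. \<exists>p\<in>Hp. \<exists>m\<in>Hm. x = p + m \<and> y = p - m)"

text \<open>The values \<open>ip x x\<close> are real by hermitian symmetry.\<close>

definition uniformly_J_positive :: "('a::complex_inner \<Rightarrow> 'a \<Rightarrow> complex) \<Rightarrow> 'a set \<Rightarrow> bool" where
  "uniformly_J_positive ip S \<longleftrightarrow>
     csubspace S \<and> (\<exists>\<alpha>>0. \<forall>x\<in>S. Re (ip x x) \<ge> \<alpha> * (norm x)\<^sup>2)"

definition uniformly_J_negative :: "('a::complex_inner \<Rightarrow> 'a \<Rightarrow> complex) \<Rightarrow> 'a set \<Rightarrow> bool" where
  "uniformly_J_negative ip S \<longleftrightarrow>
     csubspace S \<and> (\<exists>\<alpha>>0. \<forall>x\<in>S. Re (ip x x) \<le> - \<alpha> * (norm x)\<^sup>2)"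

definition maximal_uniformly_J_positive :: "('a::complex_inner \<Rightarrow> 'a \<Rightarrow> complex) \<Rightarrow> 'a set \<Rightarrow> bool" where
  "maximal_uniformly_J_positive ip S \<longleftrightarrow>
     uniformly_J_positive ip S \<and> (\<forall>S'. uniformly_J_positive ip S' \<and> S \<subseteq> S' \<longrightarrow> S' = S)"

definition maximal_uniformly_J_negative :: "('a::complex_inner \<Rightarrow> 'a \<Rightarrow> complex) \<Rightarrow> 'a set \<Rightarrow> bool" where
  "maximal_uniformly_J_negative ip S \<longleftrightarrow>
     uniformly_J_negative ip S \<and> (\<forall>S'. uniformly_J_negative ip S' \<and> S \<subseteq> S' \<longrightarrow> S' = S)"

definition Q_set :: "('a::complex_inner \<Rightarrow> 'a \<Rightarrow> complex) \<Rightarrow> ('a \<Rightarrow> 'a) set" where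
  "Q_set ip = {Q. bounded_clinear Q \<and> Q \<circ> Q = Q \<and>
     uniformly_J_positive ip (range Q) \<and> uniformly_J_negative ip {x. Q x = 0}}"

section \<open>J-frames\<close>

definition bessel_family :: "('i \<Rightarrow> 'a::complex_inner) \<Rightarrow> bool" where
  "bessel_family F \<longleftrightarrow> (\<exists>B. \<forall>f.
     (\<lambda>i. (cmod (cinner f (F i)))\<^sup>2) summable_on UNIV \<and>
     (\<Sum>\<^sub>\<infinity>i. (cmod (cinner f (F i)))\<^sup>2) \<le> B * (norm f)\<^sup>2)"

text \<open>Meaningful for Bessel families in a Hilbert space, for which the operator exists uniquely.\<close>

definition synthesis_operator :: "('i \<Rightarrow> 'a::complex_inner) \<Rightarrow> 'i ell2 \<Rightarrow> 'a" where
  "synthesis_operator F = (THE V. bounded_clinear V \<and> (\<forall>i. V (ell2_basis i) = F i))"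

definition J_frame :: "('a::complex_inner \<Rightarrow> 'a \<Rightarrow> complex) \<Rightarrow> ('i \<Rightarrow> 'a) \<Rightarrow> bool" where
  "J_frame ip F \<longleftrightarrow> bessel_family F \<and>
     maximal_uniformly_J_positive ip
       (synthesis_operator F ` ell2_on {i. Re (ip (F i) (F i)) \<ge> 0}) \<and>
     maximal_uniformly_J_negative ip
       (synthesis_operator F ` ell2_on {i. Re (ip (F i) (F i)) < 0})"

context krein_space
begin

lemma decomposition_unique:
  assumes "p \<in> Hp" "m \<in> Hm" "p' \<in> Hp" "m' \<in> Hm" "p + m = p' + m'"
  shows "p = p' \<and> m = m'"
proof -
  have "p - p' \<in> Hp" "m' - m \<in> Hm"
    using assms subspace_Hp subspace_Hm by (auto intro: complex_vector.subspace_diff)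
  moreover have e: "p - p' = m' - m"
    using assms(5) by (simp add: algebra_simps)
  ultimately have "p - p' \<in> Hp \<inter> Hm" by simp
  then have "p - p' = 0" unfolding Hp_Int_Hm by simp
  then show ?thesis using e by simp
qed

lemma fundamental_symmetry_eq:
  assumes "p \<in> Hp" "m \<in> Hm"
  shows "fundamental_symmetry Hp Hm (p + m) = p - m"
  unfolding fundamental_symmetry_def
  by (rule the_equality) (use assms decomposition_unique in blast)+

lemma ip_eq_cinner_fundamental_symmetry:
  "ip x y = cinner (fundamental_symmetry Hp Hm x) y"
proof -
  obtain p m where x: "x = p + m" "p \<in> Hp" "m \<in> Hm" using Hp_plus_Hm by blast
  obtain p' m' where y: "y = p' + m'" "p' \<in> Hp" "m' \<in> Hm" using Hp_plus_Hm by blast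
  have ip_right: "ip a (b + c) = ip a b + ip a c" for a b c
    using ip_add_left[of b c a] ip_commute[of a] by simp
  have ci_right: "cinner a (b + c) = cinner a b + cinner a c" for a b c :: 'a
    using cinner_add_left[of b c a] cinner_commute[of a] by simp
  have ip_mp: "ip m p' = 0"
    using ip_commute[of m p'] ip_orthogonal x y by simp
  have ci_mp: "cinner m p' = 0"
    using cinner_commute[of m p'] cinner_orthogonal x y by simp
  have ci_diff: "cinner (p - m) z = cinner p z - cinner m z" for z
    using cinner_add_left[of "p - m" m z] by simp
  have "cinner (p - m) y = ip x y"
    using x y by (simp add: ci_diff ci_right ip_right ip_add_left ip_mp ci_mp
      ip_orthogonal cinner_orthogonal cinner_Hp cinner_Hm)
  then show ?thesis using x fundamental_symmetry_eq by simp
qed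

end

end

theory Submission
  imports Defs
begin

text \<open>
  (1) implies (2): if \<open>V = TU\<close> synthesizes a J-frame, the images \<open>P\<close> and \<open>N\<close> of \<open>\<ell>\<^sub>2(I\<^sub>+)\<close>
  and \<open>\<ell>\<^sub>2(I\<^sub>-)\<close> span the space because \<open>V\<close> is onto, and the projection \<open>Q\<close> onto \<open>P\<close>
  along \<open>N\<close> is bounded by uniform definiteness. The range of \<open>V\<^sup>*(I-Q)\<^sup>*\<close> lies in
  \<open>\<ell>\<^sub>2(I\<^sub>-)\<close>, so \<open>QVV\<^sup>*(I-Q)\<^sup>* = 0\<close>, and \<open>VV\<^sup>* = TT\<^sup>*\<close>.

  (2) implies (3): take \<open>T\<^sub>1 = QT\<close> and \<open>T\<^sub>2 = (I-Q)T\<close>.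

  (3) implies (1): \<open>T\<^sub>2T\<^sub>1\<^sup>* = 0\<close> means that \<open>T\<^sub>1\<close> vanishes on \<open>N(T\<^sub>2)\<^sup>\<bottom>\<close>. Choose an
  orthonormal basis of \<open>\<ell>\<^sub>2(I)\<close> inside \<open>N(T\<^sub>2) \<union> N(T\<^sub>2)\<^sup>\<bottom>\<close>. It has the cardinality of \<open>I\<close>,
  so some unitary \<open>U\<close> maps the standard basis onto it; each \<open>TUe\<^sub>i\<close> then lies in \<open>R(T\<^sub>1)\<close>
  or is a nonzero vector of \<open>R(T\<^sub>2)\<close>, and its sign records which.
\<close>

section \<open>Real Hilbert spaces\<close>

text \<open>A minimizing sequence for the distance from \<open>x\<close> to \<open>S\<close> is
  Cauchy by the parallelogram law. Its limit \<open>p\<close> is a nearest point, and minimality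
  along each line through \<open>p\<close> in \<open>S\<close> forces orthogonality.\<close>

lemma orthogonal_projection_exists:
  fixes S :: "'a::{real_inner,complete_space} set"
  assumes S: "subspace S" "closed S"
  obtains p where "p \<in> S" "\<And>s. s \<in> S \<Longrightarrow> inner (x - p) s = 0"
proof -
  define d where "d = (INF s\<in>S. (norm (x - s))\<^sup>2)"
  have bdd: "bdd_below ((\<lambda>s. (norm (x - s))\<^sup>2) ` S)"
    by (rule bdd_belowI[of _ 0]) auto
  have ne: "S \<noteq> {}" using S(1) subspace_0 by blast
  have d_le: "d \<le> (norm (x - s))\<^sup>2" if "s \<in> S" for s
    unfolding d_def using bdd that by (rule cINF_lower)
  have "\<exists>s\<in>S. (norm (x - s))\<^sup>2 < d + 1 / real (Suc n)" for n
    using cInf_lessD[of "(\<lambda>s. (norm (x - s))\<^sup>2) ` S" "d + 1 / real (Suc n)"] ne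
    by (auto simp: d_def)
  then obtain s where sS: "\<And>n. s n \<in> S" and s: "\<And>n. (norm (x - s n))\<^sup>2 < d + 1 / real (Suc n)"
    by metis
  \<comment> \<open>Parallelogram law for \<open>x - s m\<close> and \<open>x - s n\<close>: their
    average is the difference between \<open>x\<close> and a midpoint in \<open>S\<close>, so its
    squared norm is at least \<open>d\<close>.\<close>
  have par: "(norm (s m - s n))\<^sup>2 \<le> 2 / real (Suc m) + 2 / real (Suc n)" for m n
  proof -
    have "(1/2) *\<^sub>R (s m + s n) \<in> S"
      using S(1) sS by (intro subspace_scale subspace_add)
    then have "d \<le> (norm (x - (1/2) *\<^sub>R (s m + s n)))\<^sup>2" by (rule d_le)
    moreover have "(norm (s m - s n))\<^sup>2 + 4 * (norm (x - (1/2) *\<^sub>R (s m + s n)))\<^sup>2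
        = 2 * (norm (x - s m))\<^sup>2 + 2 * (norm (x - s n))\<^sup>2"
      by (simp add: power2_norm_eq_inner inner_simps inner_commute algebra_simps)
    moreover have "2 / real (Suc k) = 2 * (1 / real (Suc k))" for k by simp
    ultimately show ?thesis using s[of m] s[of n] by linarith
  qed
  have "Cauchy s"
  proof (rule metric_CauchyI)
    fix e :: real assume "0 < e"
    then obtain N where N: "inverse (real (Suc N)) < e\<^sup>2 / 4"
      using reals_Archimedean[of "e\<^sup>2 / 4"] by auto
    have "dist (s m) (s n) < e" if "N \<le> m" "N \<le> n" for m n
    proof -
      have "2 / real (Suc m) \<le> 2 / real (Suc N)" "2 / real (Suc n) \<le> 2 / real (Suc N)"
        using that by (auto intro!: divide_left_mono)
      then have "(norm (s m - s n))\<^sup>2 < e\<^sup>2"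
        using par[of m n] N by (simp add: inverse_eq_divide)
      then show ?thesis
        using \<open>0 < e\<close> by (simp add: dist_norm power_less_imp_less_base)
    qed
    then show "\<exists>M. \<forall>m\<ge>M. \<forall>n\<ge>M. dist (s m) (s n) < e" by blast
  qed
  then obtain p where p: "s \<longlonglongrightarrow> p"
    using Cauchy_convergent convergent_def by blast
  have pS: "p \<in> S" using S(2) sS p by (rule closed_sequentially)
  have "(\<lambda>n. (norm (x - s n))\<^sup>2) \<longlonglongrightarrow> (norm (x - p))\<^sup>2"
    by (intro tendsto_intros p)
  moreover have "(\<lambda>n. d + 1 / real (Suc n)) \<longlonglongrightarrow> d + 0"
    using LIMSEQ_inverse_real_of_nat by (intro tendsto_intros) (simp add: inverse_eq_divide)
  ultimately have pd: "(norm (x - p))\<^sup>2 \<le> d + 0"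
    by (rule LIMSEQ_le) (use s less_imp_le in blast)
  have "inner (x - p) s = 0" if "s \<in> S" for s
  proof (cases "s = 0")
    case False
    \<comment> \<open>The optimal step along \<open>s\<close>: it lowers the squared distance by
      \<open>(inner (x - p) s)\<^sup>2 / inner s s\<close>, which minimality of \<open>p\<close>
      forbids unless the inner product vanishes.\<close>
    define t where "t = inner (x - p) s / inner s s"
    have "p + t *\<^sub>R s \<in> S" using S(1) that pS by (intro subspace_scale subspace_add)
    from order_trans[OF pd[unfolded add_0_right] d_le[OF this]]
    have "(norm (x - p))\<^sup>2 \<le> (norm (x - p - t *\<^sub>R s))\<^sup>2"
      unfolding diff_diff_eq .
    also have "\<dots> = (norm (x - p))\<^sup>2 - 2 * t * inner (x - p) s + t * t * inner s s"
      by (simp add: power2_norm_eq_inner inner_simps inner_commute algebra_simps)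
    also have "\<dots> = (norm (x - p))\<^sup>2 - (inner (x - p) s)\<^sup>2 / inner s s"
      using False by (simp add: t_def power2_eq_square)
    finally have "(inner (x - p) s)\<^sup>2 / inner s s \<le> 0" by simp
    moreover have "0 < inner s s" using False by simp
    ultimately show ?thesis by (simp add: divide_le_0_iff)
  qed simp
  with pS show thesis by (rule that)
qed

text \<open>The orthogonal complement of the kernel of a nonzero \<open>f\<close> is a line; a
  suitable multiple of a vector \<open>m\<close> spanning it represents \<open>f\<close>.\<close>

lemma Riesz_representation:
  fixes f :: "'a::{real_inner,complete_space} \<Rightarrow> real"
  assumes "bounded_linear f"
  obtains z where "\<And>x. f x = inner x z"
proof (cases "\<forall>x. f x = 0")
  case True
  then show thesis using that[of 0] by simp
next
  case False
  then obtain u where u: "f u \<noteq> 0" by blast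
  interpret f: bounded_linear f by fact
  let ?K = "{x. f x = 0}"
  have "subspace ?K"
    by (auto simp: subspace_def f.zero f.add f.scaleR)
  moreover have "closed ?K"
    by (intro closed_Collect_eq continuous_intros f.continuous_on)
  ultimately obtain p where p: "f p = 0" and o: "\<And>s. f s = 0 \<Longrightarrow> inner (u - p) s = 0"
    by (rule orthogonal_projection_exists[of ?K u]) auto
  define m where "m = u - p"
  have fm: "f m = f u" by (simp add: m_def f.diff p)
  then have m0: "inner m m \<noteq> 0" using u f.zero by auto
  show thesis
  proof (rule that[of "(f u / inner m m) *\<^sub>R m"])
    fix x
    \<comment> \<open>Since \<open>f m = f u\<close>, subtracting this multiple of \<open>m\<close>
      moves \<open>x\<close> into the kernel.\<close>
    have "inner m (x - (f x / f u) *\<^sub>R m) = 0"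
      unfolding m_def by (rule o) (use u in \<open>simp add: f.diff f.scaleR p\<close>)
    then have "inner x m = (f x / f u) * inner m m"
      by (simp add: inner_simps inner_commute)
    then show "f x = inner x ((f u / inner m m) *\<^sub>R m)"
      using u m0 by simp
  qed
qed

section \<open>Complex inner product spaces\<close>

lemma cinner_add_right: "cinner x (y + z) = cinner x y + cinner x (z :: 'a::complex_inner)"
  using cinner_add_left[of y z x] cinner_commute[of x] by simp

lemma cinner_scaleC_right: "cinner x (a *\<^sub>C y) = cnj a * cinner x (y :: 'a::complex_inner)"
  using cinner_scaleC_left[of a y x] cinner_commute[of x] by simp

lemma cinner_zero_left [simp]: "cinner 0 (y :: 'a::complex_inner) = 0"
  using cinner_add_left[of 0 0 y] by simp

lemma cinner_zero_right [simp]: "cinner (y :: 'a::complex_inner) 0 = 0"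
  using cinner_add_right[of y 0 0] by simp

lemma cinner_diff_left: "cinner (x - y) z = cinner x z - cinner y (z :: 'a::complex_inner)"
  using cinner_add_left[of "x - y" y z] by simp

lemma cinner_diff_right: "cinner x (y - z) = cinner x y - cinner x (z :: 'a::complex_inner)"
  using cinner_add_right[of x "y - z" z] by simp

lemma cinner_sum_left: "cinner (sum f A) y = (\<Sum>a\<in>A. cinner (f a) (y :: 'a::complex_inner))"
  by (induction A rule: infinite_finite_induct) (simp_all add: cinner_add_left)

lemma cinner_sum_right: "cinner y (sum f A) = (\<Sum>a\<in>A. cinner (y :: 'a::complex_inner) (f a))"
  by (induction A rule: infinite_finite_induct) (simp_all add: cinner_add_right)

lemma cinner_same: "cinner x x = complex_of_real ((norm (x :: 'a::complex_inner))\<^sup>2)"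
proof (rule complex_eqI)
  show "Re (cinner x x) = Re (complex_of_real ((norm x)\<^sup>2))"
    by (simp add: inner_eq_Re_cinner[symmetric] power2_norm_eq_inner)
  show "Im (cinner x x) = Im (complex_of_real ((norm x)\<^sup>2))"
    using arg_cong[OF cinner_commute[of x x], of Im] by simp
qed

lemma cinner_self_eq_0_iff [simp]: "cinner x x = 0 \<longleftrightarrow> x = (0 :: 'a::complex_inner)"
  by (simp add: cinner_same)

lemma cinner_eq_0_commute: "cinner x y = 0 \<longleftrightarrow> cinner y (x :: 'a::complex_inner) = 0"
  by (metis cinner_commute complex_cnj_zero)

lemma cmod_cinner_commute: "cmod (cinner x y) = cmod (cinner y (x :: 'a::complex_inner))"
  by (metis cinner_commute complex_mod_cnj)

lemma mult_cnj_eq_norm_square: "a * cnj a = complex_of_real (cmod a) ^ 2" "cnj a * a = complex_of_real (cmod a) ^ 2"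
  using complex_norm_square[of a] by (simp_all add: mult.commute)

lemma norm_scaleC: "norm (a *\<^sub>C x) = cmod a * norm (x :: 'a::complex_inner)"
proof -
  have "cinner (a *\<^sub>C x) (a *\<^sub>C x) = (a * cnj a) * cinner x x"
    by (simp add: cinner_scaleC_left cinner_scaleC_right)
  then have "complex_of_real ((norm (a *\<^sub>C x))\<^sup>2) = complex_of_real ((cmod a * norm x)\<^sup>2)"
    unfolding cinner_same mult_cnj_eq_norm_square by (simp add: power_mult_distrib)
  then have "(norm (a *\<^sub>C x))\<^sup>2 = (cmod a * norm x)\<^sup>2" by (simp only: of_real_eq_iff)
  then show ?thesis by (simp add: power2_eq_iff_nonneg)
qed

lemma complex_Cauchy_Schwarz: "cmod (cinner x y) \<le> norm x * norm (y :: 'a::complex_inner)"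
proof (cases "cinner x y = 0")
  case False
  \<comment> \<open>A unimodular factor rotating \<open>cinner x y\<close> onto the positive real
    axis, where the real Cauchy-Schwarz inequality applies.\<close>
  define c where "c = cnj (cinner x y) / cmod (cinner x y)"
  have c: "cmod c = 1" using False by (simp add: c_def norm_divide)
  have "c * cinner x y = complex_of_real ((cmod (cinner x y))\<^sup>2 / cmod (cinner x y))"
    by (simp add: c_def mult_cnj_eq_norm_square)
  also have "\<dots> = complex_of_real (cmod (cinner x y))"
    by (simp add: power2_eq_square)
  finally have "inner (c *\<^sub>C x) y = cmod (cinner x y)"
    by (simp add: inner_eq_Re_cinner cinner_scaleC_left)
  then show ?thesis
    using norm_cauchy_schwarz[of "c *\<^sub>C x" y] c by (simp add: norm_scaleC)
qed simp

lemma cinner_eqI: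
  assumes "\<And>z. cinner z x = cinner z (y :: 'a::complex_inner)"
  shows "x = y"
  using assms[of "x - y"] cinner_self_eq_0_iff[of "x - y"] by (simp only: cinner_diff_right) simp

lemma csubspace_imp_subspace: "csubspace S \<Longrightarrow> subspace (S :: 'a::complex_inner set)"
  by (auto simp: subspace_def scaleR_scaleC complex_vector.subspace_0 complex_vector.subspace_add
      complex_vector.subspace_scale)

text \<open>The real projection already works: real orthogonality to \<open>s\<close> and to
  \<open>\<i> *\<^sub>C s\<close> kills the real and the imaginary part.\<close>

lemma complex_orthogonal_projection_exists:
  fixes S :: "'a::chilbert_space set"
  assumes S: "csubspace S" "closed S"
  obtains p where "p \<in> S" "\<And>s. s \<in> S \<Longrightarrow> cinner s (x - p) = 0"
proof -
  obtain p where p: "p \<in> S" and o: "\<And>s. s \<in> S \<Longrightarrow> inner (x - p) s = 0"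
    using orthogonal_projection_exists[OF csubspace_imp_subspace[OF S(1)] S(2)] by metis
  have "cinner s (x - p) = 0" if "s \<in> S" for s
  proof (rule complex_eqI)
    show "Re (cinner s (x - p)) = Re 0"
      using o[OF that] by (simp add: inner_eq_Re_cinner[symmetric] inner_commute)
    have "\<i> *\<^sub>C s \<in> S" using S(1) that by (rule complex_vector.subspace_scale)
    from o[OF this] have "Re (\<i> * cinner s (x - p)) = 0"
      by (metis cinner_scaleC_left inner_commute inner_eq_Re_cinner)
    then show "Im (cinner s (x - p)) = Im 0" by simp
  qed
  with p show thesis by (rule that)
qed

section \<open>Bounded operators and adjoints\<close>

lemma bounded_clinearD:
  assumes "bounded_clinear f"
  shows "bounded_linear f" "f (c *\<^sub>C x) = c *\<^sub>C f x" "f (x + y) = f x + f y"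
    "f (x - y) = f x - f y" "f 0 = 0"
proof -
  interpret bounded_linear f using assms by (simp add: bounded_clinear_def)
  show "bounded_linear f" ..
  show "f (c *\<^sub>C x) = c *\<^sub>C f x" using assms by (simp add: bounded_clinear_def)
  show "f (x + y) = f x + f y" "f (x - y) = f x - f y" "f 0 = 0"
    by (fact add diff zero)+
qed

lemma bounded_clinearI:
  assumes add: "\<And>x y. f (x + y) = f x + f y" and sc: "\<And>c x. f (c *\<^sub>C x) = c *\<^sub>C f x"
    and bd: "\<And>x. norm (f x) \<le> K * norm x"
  shows "bounded_clinear f"
  unfolding bounded_clinear_def
  using sc by (auto intro!: bounded_linear_intro[of f K] add bd simp: scaleR_scaleC mult.commute)

lemma bounded_clinear_compose:
  assumes "bounded_clinear f" "bounded_clinear g"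
  shows "bounded_clinear (f \<circ> g)"
  using assms bounded_linear_compose[of f g] by (auto simp: bounded_clinear_def comp_def)

lemma bounded_clinear_diff:
  assumes "bounded_clinear f" "bounded_clinear g"
  shows "bounded_clinear (\<lambda>x. f x - g x)"
  using assms bounded_linear_sub[of f g]
  by (auto simp: bounded_clinear_def complex_vector.scale_right_diff_distrib)

lemma bounded_clinear_id_minus: "bounded_clinear Q \<Longrightarrow> bounded_clinear (\<lambda>x. x - Q x)"
  by (rule bounded_clinear_diff) (simp add: bounded_clinear_def)

lemma closed_kernel:
  assumes "bounded_clinear f"
  shows "closed {x. f x = 0}"
  using bounded_clinearD(1)[OF assms]
  by (intro closed_Collect_eq continuous_intros linear_continuous_on)

lemma csubspace_kernel: "bounded_clinear f \<Longrightarrow> csubspace {x. f x = 0}"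
  by (rule complex_vector.subspaceI) (simp_all add: bounded_clinearD(2,3,5))

lemma csubspace_range:
  assumes "bounded_clinear f"
  shows "csubspace (range f)"
proof (rule complex_vector.subspaceI)
  show "0 \<in> range f" using bounded_clinearD(5)[OF assms] by (auto intro: range_eqI[of _ _ 0])
  show "x + y \<in> range f" if "x \<in> range f" "y \<in> range f" for x y
    using that by (auto simp flip: bounded_clinearD(3)[OF assms])
  show "c *\<^sub>C x \<in> range f" if "x \<in> range f" for c x
    using that by (auto simp flip: bounded_clinearD(2)[OF assms])
qed

text \<open>The adjoint identity has at most one solution, so any map satisfying it resolves the
  definite description in \<open>cadjoint\<close>.\<close>

lemma cadjoint_eqI:
  assumes "\<And>x y. cinner (f x) y = cinner x (g y)"
  shows "cadjoint f = g"
  unfolding cadjoint_def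
proof (rule the_equality)
  fix h assume "\<forall>x y. cinner (f x) y = cinner x (h y)"
  then show "h = g" using assms by (metis cinner_eqI ext)
qed (use assms in blast)

text \<open>Existence of the adjoint: Riesz represents the real functional
  \<open>\<lambda>x. inner (f x) y\<close>, and evaluating at \<open>\<i> *\<^sub>C x\<close>
  recovers the imaginary part.\<close>

lemma cinner_cadjoint_right:
  fixes f :: "'a::chilbert_space \<Rightarrow> 'b::complex_inner"
  assumes f: "bounded_clinear f"
  shows "cinner x (cadjoint f y) = cinner (f x) y"
proof -
  have "\<exists>z. \<forall>x. cinner (f x) y = cinner x z" for y
  proof -
    have "bounded_linear (\<lambda>x. inner (f x) y)"
      using bounded_linear_inner_left bounded_clinearD(1)[OF f]
      by (rule bounded_linear_compose)
    then obtain z where z: "\<And>x. inner (f x) y = inner x z"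
      using Riesz_representation by blast
    have "cinner (f x) y = cinner x z" for x
    proof (rule complex_eqI)
      show "Re (cinner (f x) y) = Re (cinner x z)"
        using z[of x] by (simp add: inner_eq_Re_cinner)
      show "Im (cinner (f x) y) = Im (cinner x z)"
        using z[of "\<i> *\<^sub>C x"]
        by (simp add: inner_eq_Re_cinner cinner_scaleC_left bounded_clinearD(2)[OF f])
    qed
    then show ?thesis by blast
  qed
  then obtain g where g: "\<And>x y. cinner (f x) y = cinner x (g y)" by metis
  then show ?thesis using cadjoint_eqI[of f g] by simp
qed

lemma cinner_cadjoint_left:
  fixes f :: "'a::chilbert_space \<Rightarrow> 'b::complex_inner"
  assumes "bounded_clinear f"
  shows "cinner (cadjoint f y) x = cinner y (f x)"
  using cinner_cadjoint_right[OF assms, of x y] by (metis cinner_commute)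

lemma bounded_clinear_cadjoint:
  fixes f :: "'a::chilbert_space \<Rightarrow> 'b::complex_inner"
  assumes f: "bounded_clinear f"
  shows "bounded_clinear (cadjoint f)"
proof -
  obtain K where "0 \<le> K" and K: "\<And>x. norm (f x) \<le> norm x * K"
    using bounded_linear.nonneg_bounded[OF bounded_clinearD(1)[OF f]] by blast
  show ?thesis
  proof (rule bounded_clinearI)
    show "cadjoint f (x + y) = cadjoint f x + cadjoint f y" for x y
      by (rule cinner_eqI) (simp add: cinner_cadjoint_right[OF f] cinner_add_right)
    show "cadjoint f (c *\<^sub>C x) = c *\<^sub>C cadjoint f x" for c x
      by (rule cinner_eqI) (simp add: cinner_cadjoint_right[OF f] cinner_scaleC_right)
    show "norm (cadjoint f y) \<le> K * norm y" for y
    proof (cases "cadjoint f y = 0")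
      case True
      then show ?thesis using \<open>0 \<le> K\<close> by simp
    next
      case False
      \<comment> \<open>The square is bounded by \<open>K * norm y\<close> times one factor
        \<open>norm (cadjoint f y)\<close>, which is nonzero here and cancels.\<close>
      have "(norm (cadjoint f y))\<^sup>2 = cmod (cinner (f (cadjoint f y)) y)"
        by (simp add: cinner_cadjoint_right[OF f, symmetric] cinner_same norm_power)
      also have "\<dots> \<le> norm (f (cadjoint f y)) * norm y" by (rule complex_Cauchy_Schwarz)
      also have "\<dots> \<le> (norm (cadjoint f y) * K) * norm y"
        by (intro mult_right_mono K) simp
      finally show ?thesis using False by (simp add: power2_eq_square mult_ac)
    qed
  qed
qed

lemma cadjoint_compose:
  fixes f :: "'b::chilbert_space \<Rightarrow> 'c::complex_inner" and g :: "'a::chilbert_space \<Rightarrow> 'b"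
  assumes "bounded_clinear f" "bounded_clinear g"
  shows "cadjoint (f \<circ> g) = cadjoint g \<circ> cadjoint f"
  by (rule cadjoint_eqI) (simp add: cinner_cadjoint_right assms)

section \<open>Orthonormal sets\<close>

text \<open>Sets rather than families, so that Zorn's lemma and cardinal comparison apply directly;
  \<open>total_orthonormal_enumeration\<close> reattaches an index.\<close>

definition orthonormal :: "'a::complex_inner set \<Rightarrow> bool" where
  "orthonormal B \<longleftrightarrow> (\<forall>b\<in>B. \<forall>c\<in>B. cinner b c = (if b = c then 1 else 0))"

text \<open>In a complete space these are the orthonormal bases. A trivial orthogonal complement
  stands in for density of the span, which avoids infinite expansions.\<close>

definition total_orthonormal :: "'a::complex_inner set \<Rightarrow> bool" where
  "total_orthonormal B \<longleftrightarrow> orthonormal B \<and> (\<forall>x. (\<forall>b\<in>B. cinner x b = 0) \<longrightarrow> x = 0)"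

lemma orthonormal_cinner_sum:
  assumes "orthonormal B" "finite B" "c \<in> B"
  shows "cinner (\<Sum>b\<in>B. cinner x b *\<^sub>C b) c = cinner x c"
proof -
  have "cinner (\<Sum>b\<in>B. cinner x b *\<^sub>C b) c = (\<Sum>b\<in>B. if b = c then cinner x c else 0)"
    unfolding cinner_sum_left cinner_scaleC_left
    by (rule sum.cong) (use assms in \<open>auto simp: orthonormal_def\<close>)
  then show ?thesis using assms by simp
qed

lemma orthonormal_subset: "orthonormal B \<Longrightarrow> A \<subseteq> B \<Longrightarrow> orthonormal A"
  unfolding orthonormal_def by (meson subsetD)

text \<open>With \<open>s\<close> the expansion of \<open>x\<close> along \<open>B\<close>, both
  \<open>cinner x s\<close> and \<open>cinner s s\<close> equal the sum, so the two sides differ by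
  \<open>(norm (x - s))\<^sup>2\<close>.\<close>

lemma Bessel_inequality:
  assumes "orthonormal B" "finite B"
  shows "(\<Sum>b\<in>B. (cmod (cinner x b))\<^sup>2) \<le> (norm x)\<^sup>2"
proof -
  define s where "s = (\<Sum>b\<in>B. cinner x b *\<^sub>C b)"
  have xs: "cinner x s = complex_of_real (\<Sum>b\<in>B. (cmod (cinner x b))\<^sup>2)"
    by (simp add: s_def cinner_sum_right cinner_scaleC_right mult_cnj_eq_norm_square)
  \<comment> \<open>Only the second \<open>s\<close> is expanded; the coefficients
    \<open>cinner s b\<close> left over agree with \<open>cinner x b\<close> by
    orthonormality.\<close>
  have "cinner s s = (\<Sum>b\<in>B. cnj (cinner x b) * cinner s b)"
    by (subst (2) s_def) (simp add: cinner_sum_right cinner_scaleC_right)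
  also have "\<dots> = (\<Sum>b\<in>B. cnj (cinner x b) * cinner x b)"
    by (intro sum.cong) (simp_all add: s_def orthonormal_cinner_sum[OF assms])
  also have "\<dots> = complex_of_real (\<Sum>b\<in>B. (cmod (cinner x b))\<^sup>2)"
    by (simp add: mult_cnj_eq_norm_square)
  finally have ss: "cinner s s = complex_of_real (\<Sum>b\<in>B. (cmod (cinner x b))\<^sup>2)" .
  have sx: "cinner s x = complex_of_real (\<Sum>b\<in>B. (cmod (cinner x b))\<^sup>2)"
    using cinner_commute[of s x] xs by simp
  have "cinner (x - s) (x - s) = complex_of_real ((norm x)\<^sup>2 - (\<Sum>b\<in>B. (cmod (cinner x b))\<^sup>2))"
    unfolding cinner_diff_left cinner_diff_right ss sx xs by (simp add: cinner_same)
  then have "(norm (x - s))\<^sup>2 = (norm x)\<^sup>2 - (\<Sum>b\<in>B. (cmod (cinner x b))\<^sup>2)"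
    unfolding cinner_same of_real_eq_iff .
  then show ?thesis by (metis diff_ge_0_iff_ge zero_le_power2)
qed

lemma Bessel_summable:
  assumes "orthonormal B"
  shows "(\<lambda>b. (cmod (cinner x b))\<^sup>2) summable_on B"
proof (rule nonneg_bdd_above_summable_on)
  show "bdd_above (sum (\<lambda>b. (cmod (cinner x b))\<^sup>2) ` {F. F \<subseteq> B \<and> finite F})"
    using Bessel_inequality orthonormal_subset[OF assms]
    by (intro bdd_aboveI[of _ "(norm x)\<^sup>2"]) auto
qed simp

text \<open>The difference between \<open>x\<close> and its expansion is orthogonal to
  \<open>B\<close>, hence zero by totality.\<close>

lemma Parseval_finite:
  assumes B: "total_orthonormal B" "finite B"
  shows "(norm x)\<^sup>2 = (\<Sum>b\<in>B. (cmod (cinner x b))\<^sup>2)"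
proof -
  have on: "orthonormal B" using B(1) by (simp add: total_orthonormal_def)
  have "\<forall>c\<in>B. cinner (x - (\<Sum>b\<in>B. cinner x b *\<^sub>C b)) c = 0"
    by (simp add: cinner_diff_left orthonormal_cinner_sum[OF on B(2)])
  then have x: "x - (\<Sum>b\<in>B. cinner x b *\<^sub>C b) = 0"
    using B(1) unfolding total_orthonormal_def by blast
  have "cinner x x = cinner x (\<Sum>b\<in>B. cinner x b *\<^sub>C b)" using x by simp
  also have "\<dots> = complex_of_real (\<Sum>b\<in>B. (cmod (cinner x b))\<^sup>2)"
    by (simp add: cinner_sum_right cinner_scaleC_right mult_cnj_eq_norm_square)
  finally show ?thesis unfolding cinner_same of_real_eq_iff .
qed

text \<open>Used in both directions, this makes total orthonormal sets equipotent. For infinite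
  \<open>B\<close>, each member of \<open>A\<close> is non-orthogonal to some \<open>b\<close>, and
  each \<open>b\<close> accounts for only countably many members of \<open>A\<close>.\<close>

lemma orthonormal_ordLeq_total:
  includes cardinal_syntax
  fixes A B :: "'a::complex_inner set"
  assumes A: "orthonormal A" and B: "total_orthonormal B"
  shows "|A| \<le>o |B|"
proof (cases "finite B")
  case True
  have on: "orthonormal B" using B by (simp add: total_orthonormal_def)
  have norm1: "norm x = 1" if "orthonormal C" "x \<in> C" for C and x :: 'a
  proof -
    have "complex_of_real ((norm x)\<^sup>2) = complex_of_real 1"
      using that unfolding cinner_same[symmetric] by (simp add: orthonormal_def)
    then show ?thesis unfolding of_real_eq_iff by (simp add: power2_eq_1_iff)
      (smt (verit) norm_ge_zero)
  qed
  \<comment> \<open>Double counting of \<open>(cmod (cinner b a))\<^sup>2\<close>: Parseval for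
    \<open>B\<close> makes the total \<open>card F\<close>, Bessel for \<open>F\<close> bounds it by
    \<open>card B\<close>. A uniform bound over finite \<open>F\<close> also yields finiteness of
    \<open>A\<close>.\<close>
  have "card F \<le> card B" if "F \<subseteq> A" "finite F" for F
  proof -
    have F: "orthonormal F" using A that(1) by (rule orthonormal_subset)
    have "real (card F) = (\<Sum>a\<in>F. (norm a)\<^sup>2)" using norm1[OF F] by simp
    also have "\<dots> = (\<Sum>b\<in>B. \<Sum>a\<in>F. (cmod (cinner b a))\<^sup>2)"
      by (subst sum.swap) (simp add: Parseval_finite[OF B True] cmod_cinner_commute)
    also have "\<dots> \<le> (\<Sum>b\<in>B. (norm b)\<^sup>2)"
      by (intro sum_mono Bessel_inequality F that)
    also have "\<dots> = real (card B)" using norm1[OF on] by simp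
    finally show ?thesis by simp
  qed
  then have "finite A" "card A \<le> card B"
    using finite_if_finite_subsets_card_bdd[of A "card B"] by auto
  then show ?thesis using True
    by (metis card_of_ordLeq inj_on_iff_card_le)
next
  case False
  have "A \<subseteq> (\<Union>b\<in>B. {a \<in> A. cinner b a \<noteq> 0})"
  proof
    fix a assume a: "a \<in> A"
    then have "cinner a a = 1" using A by (simp add: orthonormal_def)
    then have "a \<noteq> 0" by auto
    then obtain b where "b \<in> B" "cinner a b \<noteq> 0"
      using B by (auto simp: total_orthonormal_def)
    then show "a \<in> (\<Union>b\<in>B. {a \<in> A. cinner b a \<noteq> 0})"
      using a cinner_eq_0_commute[of a b] by auto
  qed
  then have "|A| \<le>o |\<Union>b\<in>B. {a \<in> A. cinner b a \<noteq> 0}|" by (rule card_of_mono1)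
  also have "|\<Union>b\<in>B. {a \<in> A. cinner b a \<noteq> 0}| \<le>o |B|"
  proof (rule card_of_UNION_ordLeq_infinite[OF False card_of_refl[THEN ordIso_imp_ordLeq]], rule ballI)
    fix b
    \<comment> \<open>By Bessel the squares are summable over \<open>A\<close>, and a summable real
      family has countable support.\<close>
    have "countable {a \<in> A. cinner b a \<noteq> 0}"
      using summable_countable_real[OF Bessel_summable[OF A, of b]] by simp
    then have "|{a \<in> A. cinner b a \<noteq> 0}| \<le>o |UNIV :: nat set|"
      unfolding countable_def card_of_ordLeq[symmetric] by simp
    also have "|UNIV :: nat set| \<le>o |B|" using False by (simp add: infinite_iff_card_of_nat)
    finally show "|{a \<in> A. cinner b a \<noteq> 0}| \<le>o |B|" .
  qed
  finally show ?thesis .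
qed

text \<open>Zorn's lemma is applied to the orthonormal subsets of \<open>S \<union> S'\<close> only,
  with \<open>S'\<close> the orthogonal complement, so that the basis respects the
  splitting.\<close>

lemma total_orthonormal_within_closed_subspace:
  fixes S :: "'a::chilbert_space set"
  assumes S: "csubspace S" "closed S"
  obtains B where "total_orthonormal B" "\<And>b. b \<in> B \<Longrightarrow> b \<in> S \<or> (\<forall>s\<in>S. cinner s b = 0)"
proof -
  define S' where "S' = {x. \<forall>s\<in>S. cinner s x = 0}"
  define \<A> where "\<A> = {B. B \<subseteq> S \<union> S' \<and> orthonormal B}"
  have "\<Union>C \<in> \<A>" if C: "subset.chain \<A> C" for C
  proof -
    have "\<exists>X\<in>C. b \<in> X \<and> c \<in> X" if "b \<in> \<Union>C" "c \<in> \<Union>C" for b c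
      using that C unfolding subset_chain_def by blast
    moreover have "orthonormal X" if "X \<in> C" for X
      using C that unfolding \<A>_def subset_chain_def by blast
    ultimately have "orthonormal (\<Union>C)"
      unfolding orthonormal_def by meson
    then show ?thesis using C by (auto simp: \<A>_def subset_chain_def)
  qed
  then have "\<exists>M\<in>\<A>. \<forall>X\<in>\<A>. M \<subseteq> X \<longrightarrow> X = M" by (rule subset_Zorn')
  then obtain B where B: "B \<in> \<A>" and max: "\<And>X. X \<in> \<A> \<Longrightarrow> B \<subseteq> X \<Longrightarrow> X = B" by blast
  have on: "orthonormal B" using B by (simp add: \<A>_def)
  have S': "csubspace S'"
    by (auto simp: S'_def complex_vector.subspace_def cinner_add_right cinner_scaleC_right)
  \<comment> \<open>Maximality: a nonzero such \<open>x\<close> could be normalized and added to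
    \<open>B\<close>.\<close>
  have zero: "x = 0" if x: "x \<in> S \<union> S'" and o: "\<And>b. b \<in> B \<Longrightarrow> cinner x b = 0" for x
  proof (rule ccontr)
    assume "x \<noteq> 0"
    define y where "y = complex_of_real (1 / norm x) *\<^sub>C x"
    have ox: "cinner b x = 0" if "b \<in> B" for b using o[OF that] cinner_eq_0_commute by blast
    have yy: "cinner y y = 1"
      using \<open>x \<noteq> 0\<close> unfolding cinner_same by (simp add: y_def norm_scaleC norm_divide)
    have yb: "cinner y b = 0" "cinner b y = 0" if "b \<in> B" for b
      using o[OF that] ox[OF that] by (simp_all add: y_def cinner_scaleC_left cinner_scaleC_right)
    have "y \<notin> B" using yb(1) yy by force
    have "y \<in> S \<union> S'"
      using x complex_vector.subspace_scale[OF S(1)] complex_vector.subspace_scale[OF S']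
      unfolding y_def by blast
    moreover have "orthonormal (insert y B)"
      using on yb yy \<open>y \<notin> B\<close> unfolding orthonormal_def ball_simps by fastforce
    ultimately have "insert y B = B"
      using B by (intro max) (simp_all add: \<A>_def subset_insertI)
    then show False using \<open>y \<notin> B\<close> by blast
  qed
  have "x = 0" if o: "\<And>b. b \<in> B \<Longrightarrow> cinner x b = 0" for x
  proof -
    obtain p where p: "p \<in> S" and "\<And>s. s \<in> S \<Longrightarrow> cinner s (x - p) = 0"
      using complex_orthogonal_projection_exists[OF S] by metis
    then have xp: "x - p \<in> S'" by (auto simp: S'_def)
    \<comment> \<open>Each \<open>b\<close> lies in \<open>S\<close> or in \<open>S'\<close>, hence
      is orthogonal to one of the two pieces of \<open>x\<close>; orthogonality to \<open>x\<close>
      then gives the other.\<close>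
    have 1: "cinner p b = 0 \<and> cinner (x - p) b = 0" if b: "b \<in> B" for b
    proof (cases "b \<in> S")
      case True
      then have "cinner b (x - p) = 0" using xp by (auto simp: S'_def)
      then show ?thesis
        using o[OF b] cinner_eq_0_commute[of b "x - p"] by (simp add: cinner_diff_left)
    next
      case False
      then have "b \<in> S'" using B b by (auto simp: \<A>_def)
      then have "cinner p b = 0" using p by (simp add: S'_def)
      then show ?thesis using o[OF b] by (simp add: cinner_diff_left)
    qed
    have "p = 0" "x - p = 0"
      using zero 1 p xp by blast+
    then show "x = 0" by simp
  qed
  then have "total_orthonormal B" using on by (auto simp: total_orthonormal_def)
  then show thesis using B by (intro that[of B]) (auto simp: \<A>_def S'_def)
qed

section \<open>The space of square summable families\<close>

lemma ell2_cinner_sum: "cinner x y = (\<Sum>\<^sub>\<infinity>i. ell2_coord x i * cnj (ell2_coord y i))"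
  by transfer simp

lemma ell2_norm_sum: "(norm x)\<^sup>2 = (\<Sum>\<^sub>\<infinity>i. (cmod (ell2_coord x i))\<^sup>2)"
proof -
  have "(\<lambda>i. ell2_coord x i * cnj (ell2_coord x i)) summable_on UNIV"
    using ell2_coord[of x] by (intro ell2_mult_summable) auto
  then have "Re (cinner x x) = (\<Sum>\<^sub>\<infinity>i. (cmod (ell2_coord x i))\<^sup>2)"
    by (simp add: ell2_cinner_sum infsum_Re[symmetric] mult_cnj_eq_norm_square
        flip: of_real_power)
  then show ?thesis by (simp add: cinner_same)
qed

lemma ell2_sum_le_norm:
  assumes "finite F"
  shows "(\<Sum>i\<in>F. (cmod (ell2_coord x i))\<^sup>2) \<le> (norm x)\<^sup>2"
  unfolding ell2_norm_sum using ell2_coord[of x] assms by (intro finite_sum_le_infsum) auto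

lemma ell2_coord_eq_cinner: "ell2_coord x i = cinner x (ell2_basis i)"
proof -
  have "cinner x (ell2_basis i) = (\<Sum>\<^sub>\<infinity>j\<in>{i}. ell2_coord x j)"
    unfolding ell2_cinner_sum ell2_basis.rep_eq by (rule infsum_cong_neutral) auto
  then show ?thesis by simp
qed

lemma ell2_coord_diff: "ell2_coord (x - y) i = ell2_coord x i - ell2_coord y i"
  by (simp add: minus_ell2.rep_eq)

lemma ell2_coord_zero [simp]: "ell2_coord 0 i = 0"
  by (simp add: zero_ell2.rep_eq)

lemma ell2_eqI: "(\<And>i. ell2_coord x i = ell2_coord y i) \<Longrightarrow> x = y"
  by transfer auto

text \<open>The way to build elements of the space from coordinates: limits, analysis coefficients
  and truncations are all obtained through it.\<close>

lemma ell2_bounded_partial_sums: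
  assumes "\<And>F. finite F \<Longrightarrow> (\<Sum>i\<in>F. (cmod (x i))\<^sup>2) \<le> C"
  obtains y where "\<And>i. ell2_coord y i = x i" "(norm y)\<^sup>2 \<le> C"
proof
  have s: "(\<lambda>i. (cmod (x i))\<^sup>2) summable_on UNIV"
    by (rule nonneg_bdd_above_summable_on) (auto intro!: bdd_aboveI[of _ C] assms)
  then show 1: "ell2_coord (Abs_ell2 x) i = x i" for i
    by (simp add: Abs_ell2_inverse)
  show "(norm (Abs_ell2 x))\<^sup>2 \<le> C"
    unfolding ell2_norm_sum 1 using s assms by (intro infsum_le_finite_sums) auto
qed

text \<open>Coordinates of a Cauchy sequence converge; bounds on finite sums survive the limit and
  upgrade this to convergence in norm.\<close>

instance ell2 :: (type) chilbert_space
proof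
  fix X :: "nat \<Rightarrow> 'a ell2"
  assume X: "Cauchy X"
  have coord_le: "cmod (ell2_coord x i) \<le> norm x" for x :: "'a ell2" and i
    using ell2_sum_le_norm[of "{i}" x] by (simp add: power_mono_iff)
  have "Cauchy (\<lambda>n. ell2_coord (X n) i)" for i
  proof (rule metric_CauchyI)
    fix e :: real assume "0 < e"
    with X obtain M where "\<forall>m\<ge>M. \<forall>n\<ge>M. dist (X m) (X n) < e" by (auto simp: Cauchy_def)
    then have "\<forall>m\<ge>M. \<forall>n\<ge>M. dist (ell2_coord (X m) i) (ell2_coord (X n) i) < e"
      using coord_le by (metis dist_norm ell2_coord_diff le_less_trans)
    then show "\<exists>M. \<forall>m\<ge>M. \<forall>n\<ge>M. dist (ell2_coord (X m) i) (ell2_coord (X n) i) < e" by blast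
  qed
  then have "\<forall>i. \<exists>l. (\<lambda>n. ell2_coord (X n) i) \<longlonglongrightarrow> l"
    using Cauchy_convergent convergent_def by blast
  then obtain l where l: "\<And>i. (\<lambda>n. ell2_coord (X n) i) \<longlonglongrightarrow> l i" by metis
  \<comment> \<open>The index \<open>n\<close> tends to infinity inside a finite sum while
    \<open>m\<close> stays fixed, so the bound is uniform in \<open>F\<close>.\<close>
  have tail: "(\<Sum>i\<in>F. (cmod (ell2_coord (X m) i - l i))\<^sup>2) \<le> e\<^sup>2"
    if "finite F" "0 < e" "\<forall>n\<ge>N. dist (X m) (X n) < e" for F m N and e :: real
  proof (rule LIMSEQ_le_const2)
    show "(\<lambda>n. \<Sum>i\<in>F. (cmod (ell2_coord (X m) i - ell2_coord (X n) i))\<^sup>2)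
        \<longlonglongrightarrow> (\<Sum>i\<in>F. (cmod (ell2_coord (X m) i - l i))\<^sup>2)"
      by (intro tendsto_intros l)
    have "(\<Sum>i\<in>F. (cmod (ell2_coord (X m) i - ell2_coord (X n) i))\<^sup>2) \<le> e\<^sup>2" if "N \<le> n" for n
    proof -
      have "(\<Sum>i\<in>F. (cmod (ell2_coord (X m) i - ell2_coord (X n) i))\<^sup>2) \<le> (norm (X m - X n))\<^sup>2"
        using ell2_sum_le_norm[OF \<open>finite F\<close>] by (simp flip: ell2_coord_diff)
      also have "\<dots> \<le> e\<^sup>2"
        using \<open>\<forall>n\<ge>N. dist (X m) (X n) < e\<close> that by (intro power_mono) (auto simp: dist_norm less_imp_le)
      finally show ?thesis .
    qed
    then show "\<exists>N. \<forall>n\<ge>N. (\<Sum>i\<in>F. (cmod (ell2_coord (X m) i - ell2_coord (X n) i))\<^sup>2) \<le> e\<^sup>2"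
      by blast
  qed
  have close: "\<exists>y. (\<forall>i. ell2_coord y i = ell2_coord (X m) i - l i) \<and> norm y \<le> e"
    if "0 < e" "\<forall>n\<ge>N. dist (X m) (X n) < e" for m N and e :: real
    using ell2_bounded_partial_sums[of "\<lambda>i. ell2_coord (X m) i - l i" "e\<^sup>2"] tail[OF _ that] that(1)
    by (metis less_imp_le power2_le_imp_le)
  \<comment> \<open>Square summability of \<open>l\<close> comes indirectly: \<open>y\<close>
    represents \<open>X N\<close> minus \<open>l\<close>, so \<open>X N - y\<close> is the element
    with coordinates \<open>l\<close>.\<close>
  obtain N where "\<forall>m\<ge>N. \<forall>n\<ge>N. dist (X m) (X n) < 1"
    using X by (auto simp: Cauchy_def) (metis zero_less_one)
  then obtain y where y: "\<And>i. ell2_coord y i = ell2_coord (X N) i - l i"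
    using close[of 1 N N] by auto
  have "X \<longlonglongrightarrow> X N - y"
  proof (rule metric_LIMSEQ_I)
    fix e :: real assume "0 < e"
    then obtain M where M: "\<forall>m\<ge>M. \<forall>n\<ge>M. dist (X m) (X n) < e / 2"
      using X half_gt_zero[of e] unfolding Cauchy_def by blast
    have "dist (X m) (X N - y) < e" if "M \<le> m" for m
    proof -
      have "\<forall>n\<ge>M. dist (X m) (X n) < e / 2" using M that by blast
      from close[OF half_gt_zero[OF \<open>0 < e\<close>] this] obtain z where
        z: "\<And>i. ell2_coord z i = ell2_coord (X m) i - l i" and "norm z \<le> e / 2" by blast
      have "X m - (X N - y) = z"
        by (rule ell2_eqI) (simp add: ell2_coord_diff y z)
      then show ?thesis using \<open>norm z \<le> e / 2\<close> \<open>0 < e\<close> by (simp add: dist_norm)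
    qed
    then show "\<exists>M. \<forall>m\<ge>M. dist (X m) (X N - y) < e" by blast
  qed
  then show "convergent X" by (rule convergentI)
qed

section \<open>The standard basis, orthonormal bases and unitaries\<close>

lemma inj_ell2_basis: "inj ell2_basis"
proof (rule injI)
  fix i j :: 'a assume "ell2_basis i = ell2_basis j"
  from arg_cong[OF this, of "\<lambda>x. ell2_coord x i"] show "i = j"
    by (simp add: ell2_basis.rep_eq split: if_splits)
qed

lemma total_orthonormal_ell2_basis: "total_orthonormal (range ell2_basis)"
  unfolding total_orthonormal_def orthonormal_def
proof (intro conjI ballI allI impI)
  fix b c :: "'a ell2" assume "b \<in> range ell2_basis" "c \<in> range ell2_basis"
  then show "cinner b c = (if b = c then 1 else 0)"
    by (auto simp: ell2_coord_eq_cinner[symmetric] ell2_basis.rep_eq inj_eq[OF inj_ell2_basis])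
next
  fix x :: "'a ell2" assume "\<forall>b\<in>range ell2_basis. cinner x b = 0"
  then have "ell2_coord x i = 0" for i by (simp add: ell2_coord_eq_cinner)
  then show "x = 0" using ell2_eqI[of x 0] by simp
qed

text \<open>\<open>B\<close> and the standard basis bound each other in cardinality, and the
  standard basis is a copy of the index type.\<close>

lemma total_orthonormal_enumeration:
  fixes B :: "'i ell2 set"
  assumes "total_orthonormal B"
  obtains \<phi> where "bij_betw \<phi> (UNIV :: 'i set) B"
proof -
  have E: "total_orthonormal (range (ell2_basis :: 'i \<Rightarrow> 'i ell2))"
    by (rule total_orthonormal_ell2_basis)
  have "\<exists>f. bij_betw f (range (ell2_basis :: 'i \<Rightarrow> 'i ell2)) B"
    unfolding card_of_ordIso ordIso_iff_ordLeq
    using orthonormal_ordLeq_total[OF _ assms] orthonormal_ordLeq_total[OF _ E] assms E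
    by (simp add: total_orthonormal_def)
  then obtain f where f: "bij_betw f (range (ell2_basis :: 'i \<Rightarrow> 'i ell2)) B" by blast
  have "bij_betw (f \<circ> ell2_basis) UNIV B"
    by (rule bij_betw_trans[OF inj_on_imp_bij_betw[OF inj_ell2_basis] f])
  then show thesis by (rule that)
qed

text \<open>The values on the basis are exactly the coordinates of the adjoints, so the adjoints
  agree, and with them the operators.\<close>

lemma bounded_clinear_eq_on_ell2_basis:
  fixes f g :: "'i ell2 \<Rightarrow> 'b::complex_inner"
  assumes f: "bounded_clinear f" and g: "bounded_clinear g"
    and eq: "\<And>i. f (ell2_basis i) = g (ell2_basis i)"
  shows "f = g"
proof
  fix x
  show "f x = g x"
  proof (rule cinner_eqI)
    fix z
    have "cadjoint f z = cadjoint g z"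
      by (rule ell2_eqI)
        (simp add: ell2_coord_eq_cinner cinner_cadjoint_left f g eq)
    then show "cinner z (f x) = cinner z (g x)"
      by (metis cinner_cadjoint_left f g)
  qed
qed

text \<open>The analysis operator \<open>W\<close>, with coefficients
  \<open>cinner y (\<phi> i)\<close>, is a contraction by Bessel; its adjoint is the required
  unitary.\<close>

lemma unitary_from_enumeration:
  fixes \<phi> :: "'i \<Rightarrow> 'i ell2"
  assumes B: "total_orthonormal B" and \<phi>: "bij_betw \<phi> UNIV B"
  obtains U where "unitary_operator U" "\<And>i. U (ell2_basis i) = \<phi> i"
proof -
  have inj: "inj \<phi>" and B_eq: "B = range \<phi>"
    using \<phi> by (simp_all add: bij_betw_def)
  have on: "orthonormal B" using B by (simp add: total_orthonormal_def)
  have "\<exists>z. (\<forall>i. ell2_coord z i = cinner y (\<phi> i)) \<and> (norm z)\<^sup>2 \<le> (norm y)\<^sup>2" for y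
  proof -
    have "(\<Sum>i\<in>F. (cmod (cinner y (\<phi> i)))\<^sup>2) \<le> (norm y)\<^sup>2" if "finite F" for F
    proof -
      have "(\<Sum>i\<in>F. (cmod (cinner y (\<phi> i)))\<^sup>2) = (\<Sum>b\<in>\<phi> ` F. (cmod (cinner y b))\<^sup>2)"
        using inj by (simp add: sum.reindex inj_on_subset)
      also have "\<dots> \<le> (norm y)\<^sup>2"
        by (intro Bessel_inequality orthonormal_subset[OF on]) (use that B_eq in auto)
      finally show ?thesis .
    qed
    then show ?thesis by (metis ell2_bounded_partial_sums)
  qed
  then obtain W where W: "\<And>y i. ell2_coord (W y) i = cinner y (\<phi> i)"
    and W_le: "\<And>y. (norm (W y))\<^sup>2 \<le> (norm y)\<^sup>2"
    by metis
  have bW: "bounded_clinear W"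
  proof (rule bounded_clinearI[where K = 1])
    show "W (x + y) = W x + W y" for x y
      by (rule ell2_eqI) (simp add: W plus_ell2.rep_eq cinner_add_left)
    show "W (c *\<^sub>C x) = c *\<^sub>C W x" for c x
      by (rule ell2_eqI) (simp add: W scaleC_ell2.rep_eq cinner_scaleC_left)
    show "norm (W x) \<le> 1 * norm x" for x
      using power2_le_imp_le[OF W_le[of x]] by simp
  qed
  define U where "U = cadjoint W"
  have bU: "bounded_clinear U" unfolding U_def by (rule bounded_clinear_cadjoint[OF bW])
  have U_basis: "U (ell2_basis i) = \<phi> i" for i
  proof (rule cinner_eqI)
    fix z
    show "cinner z (U (ell2_basis i)) = cinner z (\<phi> i)"
      by (simp add: U_def cinner_cadjoint_right[OF bW] ell2_coord_eq_cinner[symmetric] W)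
  qed
  have adj: "cadjoint U = W"
    by (rule cadjoint_eqI) (simp add: U_def cinner_cadjoint_left[OF bW])
  have WU: "W \<circ> U = id"
  proof (rule bounded_clinear_eq_on_ell2_basis[OF bounded_clinear_compose[OF bW bU]])
    show "bounded_clinear (id :: 'i ell2 \<Rightarrow> 'i ell2)"
      by (simp add: bounded_clinear_def id_def)
    show "(W \<circ> U) (ell2_basis i) = id (ell2_basis i)" for i
    proof (rule ell2_eqI)
      fix j
      have "cinner (\<phi> i) (\<phi> j) = (if \<phi> i = \<phi> j then 1 else 0)"
        using on by (auto simp: orthonormal_def B_eq)
      then show "ell2_coord ((W \<circ> U) (ell2_basis i)) j = ell2_coord (id (ell2_basis i)) j"
        by (simp add: U_basis W ell2_basis.rep_eq inj_eq[OF inj] eq_commute)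
    qed
  qed
  have UW: "U \<circ> W = id"
  proof
    fix y
    \<comment> \<open>A vector killed by \<open>W\<close> is orthogonal to all of \<open>B\<close>,
      so totality turns the left inverse \<open>W\<close> into a two-sided one.\<close>
    have "W (U (W y) - y) = 0"
      using fun_cong[OF WU, of "W y"] by (simp add: bounded_clinearD(4)[OF bW])
    then have "\<forall>b\<in>B. cinner (U (W y) - y) b = 0"
      by (auto simp: B_eq simp flip: W)
    then have "U (W y) - y = 0" using B unfolding total_orthonormal_def by blast
    then show "(U \<circ> W) y = id y" by simp
  qed
  show thesis
    by (rule that[of U]) (simp_all add: unitary_operator_def bU adj WU UW U_basis)
qed

section \<open>Coordinate subspaces and synthesis operators\<close>

lemma ell2_on_split:
  obtains y z where "y \<in> ell2_on A" "z \<in> ell2_on (- A)" "x = y + z"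
proof -
  have part: "\<exists>y. \<forall>i. ell2_coord y i = (if i \<in> C then ell2_coord x i else 0)" for C
  proof -
    have "(\<Sum>i\<in>F. (cmod (if i \<in> C then ell2_coord x i else 0))\<^sup>2) \<le> (norm x)\<^sup>2" if "finite F" for F
    proof -
      have "(\<Sum>i\<in>F. (cmod (if i \<in> C then ell2_coord x i else 0))\<^sup>2) \<le> (\<Sum>i\<in>F. (cmod (ell2_coord x i))\<^sup>2)"
        by (rule sum_mono) simp
      also have "\<dots> \<le> (norm x)\<^sup>2" using that by (rule ell2_sum_le_norm)
      finally show ?thesis .
    qed
    from ell2_bounded_partial_sums[OF this] show ?thesis by blast
  qed
  obtain y where "\<And>i. ell2_coord y i = (if i \<in> A then ell2_coord x i else 0)"
    using part[of A] by blast
  moreover obtain z where "\<And>i. ell2_coord z i = (if i \<in> - A then ell2_coord x i else 0)"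
    using part[of "- A"] by blast
  moreover from calculation have "x = y + z"
    by (intro ell2_eqI) (simp add: plus_ell2.rep_eq)
  ultimately show thesis by (intro that[of y z]) (auto simp: ell2_on_def)
qed

lemma ell2_basis_in_ell2_on: "i \<in> A \<Longrightarrow> ell2_basis i \<in> ell2_on A"
  by (auto simp: ell2_on_def ell2_basis.rep_eq)

text \<open>After moving \<open>f\<close> across the inner product, the coordinates of
  \<open>cadjoint f z\<close> vanish on \<open>A\<close> and those of \<open>x\<close> vanish off
  \<open>A\<close>.\<close>

lemma bounded_clinear_vanishes_on_ell2_on:
  fixes f :: "'i ell2 \<Rightarrow> 'b::complex_inner"
  assumes f: "bounded_clinear f" and 0: "\<And>i. i \<in> A \<Longrightarrow> f (ell2_basis i) = 0"
    and x: "x \<in> ell2_on A"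
  shows "f x = 0"
proof (rule cinner_eqI)
  fix z
  have 1: "ell2_coord (cadjoint f z) i * cnj (ell2_coord x i) = 0" for i
  proof (cases "i \<in> A")
    case True
    then show ?thesis by (simp add: ell2_coord_eq_cinner[of "cadjoint f z"] cinner_cadjoint_left[OF f] 0)
  next
    case False
    then show ?thesis using x by (simp add: ell2_on_def)
  qed
  have "cinner (cadjoint f z) x = 0" unfolding ell2_cinner_sum by (rule infsum_0) (rule 1)
  then show "cinner z (f x) = cinner z 0" by (simp add: cinner_cadjoint_left[OF f])
qed

lemma synthesis_operator_eqI:
  assumes V: "bounded_clinear V" and F: "\<And>i. V (ell2_basis i) = F i"
  shows "synthesis_operator F = V"
  unfolding synthesis_operator_def
proof (rule the_equality)
  fix W assume "bounded_clinear W \<and> (\<forall>i. W (ell2_basis i) = F i)"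
  then show "W = V" using V F by (intro bounded_clinear_eq_on_ell2_basis) simp_all
qed (use assms in blast)

text \<open>The coefficients of \<open>f\<close> are the coordinates of \<open>cadjoint V f\<close>,
  so the squared norm of the adjoint is a Bessel bound.\<close>

lemma bessel_family_image_ell2_basis:
  fixes V :: "'i ell2 \<Rightarrow> 'a::complex_inner"
  assumes V: "bounded_clinear V"
  shows "bessel_family (\<lambda>i. V (ell2_basis i))"
proof -
  obtain K where K: "\<And>x. norm (cadjoint V x) \<le> norm x * K"
    using bounded_linear.bounded[OF bounded_clinearD(1)[OF bounded_clinear_cadjoint[OF V]]] by blast
  have c: "cinner f (V (ell2_basis i)) = ell2_coord (cadjoint V f) i" for f i
    by (simp add: ell2_coord_eq_cinner cinner_cadjoint_left[OF V])
  have "(\<Sum>\<^sub>\<infinity>i. (cmod (cinner f (V (ell2_basis i))))\<^sup>2) \<le> K\<^sup>2 * (norm f)\<^sup>2" for f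
  proof -
    have "(norm (cadjoint V f))\<^sup>2 \<le> (norm f * K)\<^sup>2" using K by (intro power_mono) auto
    then show ?thesis unfolding c ell2_norm_sum[symmetric] by (simp add: power_mult_distrib mult.commute)
  qed
  moreover have "(\<lambda>i. (cmod (cinner f (V (ell2_basis i))))\<^sup>2) summable_on UNIV" for f
    unfolding c using ell2_coord by blast
  ultimately show ?thesis unfolding bessel_family_def by blast
qed

section \<open>Krein spaces\<close>

context krein_space
begin

lemma ip_add_right: "ip x (y + z) = ip x y + ip x z"
  using ip_add_left[of y z x] ip_commute[of x] by simp

text \<open>The fundamental symmetry is isometric because \<open>p\<close> and \<open>m\<close> are
  orthogonal; Cauchy-Schwarz does the rest.\<close>

lemma norm_ip_le: "cmod (ip x y) \<le> norm x * norm y"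
proof -
  obtain p m where x: "x = p + m" "p \<in> Hp" "m \<in> Hm" using Hp_plus_Hm by blast
  have "cinner p m = 0" "cinner m p = 0"
    using x cinner_orthogonal cinner_eq_0_commute by blast+
  then have "cinner (p - m) (p - m) = cinner (p + m) (p + m)"
    by (simp add: cinner_diff_left cinner_diff_right cinner_add_left cinner_add_right)
  then have "(norm (p - m))\<^sup>2 = (norm (p + m))\<^sup>2"
    unfolding cinner_same of_real_eq_iff .
  then have "norm (fundamental_symmetry Hp Hm x) = norm x"
    using x by (simp add: fundamental_symmetry_eq power2_eq_iff_nonneg)
  then show ?thesis
    unfolding ip_eq_cinner_fundamental_symmetry using complex_Cauchy_Schwarz by metis
qed

lemma uniformly_definite_Int:
  assumes "uniformly_J_positive ip P" "uniformly_J_negative ip N" "x \<in> P" "x \<in> N"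
  shows "x = 0"
proof -
  obtain \<alpha> \<beta> where "\<alpha> > 0" "\<beta> > 0" "\<alpha> * (norm x)\<^sup>2 \<le> Re (ip x x)" "Re (ip x x) \<le> - \<beta> * (norm x)\<^sup>2"
    using assms unfolding uniformly_J_positive_def uniformly_J_negative_def by blast
  then have "(\<alpha> + \<beta>) * (norm x)\<^sup>2 \<le> 0" by (simp add: algebra_simps)
  then show ?thesis using \<open>\<alpha> > 0\<close> \<open>\<beta> > 0\<close> by (simp add: mult_le_0_iff)
qed

text \<open>If a positive \<open>S\<close> contains \<open>P\<close> and \<open>s = p + n\<close>
  lies in \<open>S\<close>, then \<open>n = s - p\<close> is in both \<open>S\<close> and
  \<open>N\<close>, hence zero. The negative case is symmetric.\<close>

lemma maximal_of_complement:
  assumes P: "uniformly_J_positive ip P" and N: "uniformly_J_negative ip N"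
    and sum: "\<And>x. \<exists>p\<in>P. \<exists>n\<in>N. x = p + n"
  shows "maximal_uniformly_J_positive ip P" "maximal_uniformly_J_negative ip N"
proof -
  have "S \<subseteq> P" if S: "uniformly_J_positive ip S" "P \<subseteq> S" for S
  proof
    fix s assume "s \<in> S"
    obtain p n where s: "p \<in> P" "n \<in> N" "s = p + n" using sum by blast
    have "s - p \<in> S"
      using S s(1) \<open>s \<in> S\<close> complex_vector.subspace_diff unfolding uniformly_J_positive_def by blast
    then have "n = 0" using uniformly_definite_Int[OF S(1) N, of n] s by simp
    then show "s \<in> P" using s by simp
  qed
  then show "maximal_uniformly_J_positive ip P"
    using P unfolding maximal_uniformly_J_positive_def by blast
  have "S \<subseteq> N" if S: "uniformly_J_negative ip S" "N \<subseteq> S" for S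
  proof
    fix s assume "s \<in> S"
    obtain p n where s: "p \<in> P" "n \<in> N" "s = p + n" using sum by blast
    have "s - n \<in> S"
      using S s(2) \<open>s \<in> S\<close> complex_vector.subspace_diff unfolding uniformly_J_negative_def by blast
    then have "p = 0" using uniformly_definite_Int[OF P S(1), of p] s by simp
    then show "s \<in> N" using s by simp
  qed
  then show "maximal_uniformly_J_negative ip N"
    using N unfolding maximal_uniformly_J_negative_def by blast
qed

text \<open>Continuity of the projection onto \<open>P\<close> along \<open>N\<close>. With
  \<open>x = p + n\<close>, the sign of \<open>ip n n\<close> bounds \<open>Re (ip p p)\<close> by
  \<open>2 * norm p * norm x\<close> plus the square of \<open>norm x\<close>.\<close>

lemma uniformly_definite_summand_bound:
  assumes P: "uniformly_J_positive ip P" and N: "uniformly_J_negative ip N"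
  shows "\<exists>K. \<forall>p\<in>P. \<forall>n\<in>N. norm p \<le> K * norm (p + n)"
proof -
  obtain \<alpha> where "\<alpha> > 0" and \<alpha>: "\<And>x. x \<in> P \<Longrightarrow> \<alpha> * (norm x)\<^sup>2 \<le> Re (ip x x)"
    using P unfolding uniformly_J_positive_def by blast
  obtain \<beta> where "\<beta> > 0" and \<beta>: "\<And>x. x \<in> N \<Longrightarrow> Re (ip x x) \<le> - \<beta> * (norm x)\<^sup>2"
    using N unfolding uniformly_J_negative_def by blast
  \<comment> \<open>The constant 1 serves when \<open>norm p \<le> norm x\<close>. Otherwise all
    three terms are at most \<open>norm p * norm x\<close>, and dividing by \<open>norm p\<close>
    gives \<open>3 / \<alpha>\<close>.\<close>
  have "norm p \<le> max 1 (3 / \<alpha>) * norm (p + n)" if p: "p \<in> P" and n: "n \<in> N" for p n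
  proof (cases "norm p \<le> norm (p + n)")
    case True
    then show ?thesis
      using mult_right_mono[of 1 "max 1 (3 / \<alpha>)" "norm (p + n)"] by simp
  next
    case False
    define x where "x = p + n"
    have "Re (ip x x) + Re (ip p p) = Re (ip n n) + Re (ip p x) + Re (ip x p)"
      by (simp add: x_def ip_add_left ip_add_right)
    moreover have "Re (ip n n) \<le> 0"
      using order_trans[OF \<beta>[OF n], of 0] \<open>\<beta> > 0\<close> by simp
    moreover have "Re (ip p x) \<le> norm p * norm x" "Re (ip x p) \<le> norm p * norm x"
      using order_trans[OF complex_Re_le_cmod norm_ip_le[of p x]]
        order_trans[OF complex_Re_le_cmod norm_ip_le[of x p]] by (simp_all add: mult.commute)
    moreover have "- Re (ip x x) \<le> norm x * norm x"
      using norm_ip_le[of x x] abs_Re_le_cmod[of "ip x x"] by linarith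
    moreover have "norm x * norm x \<le> norm p * norm x"
      using False by (intro mult_right_mono) (simp_all add: x_def)
    ultimately have "\<alpha> * (norm p)\<^sup>2 \<le> 3 * (norm p * norm x)"
      using \<alpha>[OF p] by linarith
    moreover have "norm p > 0" using False norm_ge_zero[of "p + n"] by linarith
    moreover have "(\<alpha> * norm p) * norm p = \<alpha> * (norm p)\<^sup>2"
      "(3 * norm x) * norm p = 3 * (norm p * norm x)"
      by (simp_all add: power2_eq_square)
    ultimately have "\<alpha> * norm p \<le> 3 * norm x"
      by (metis mult_le_cancel_right_pos)
    then have "norm p \<le> (3 / \<alpha>) * norm x"
      using \<open>\<alpha> > 0\<close> by (simp add: pos_le_divide_eq mult.commute)
    also have "\<dots> \<le> max 1 (3 / \<alpha>) * norm x" by (intro mult_right_mono) auto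
    finally show ?thesis by (simp add: x_def)
  qed
  then show ?thesis by blast
qed

text \<open>\<open>Q\<close> is the projection onto \<open>P\<close> along \<open>N\<close>: trivial
  intersection makes it well defined and linear, the summand bound makes it bounded.\<close>

lemma Q_set_of_decomposition:
  assumes P: "uniformly_J_positive ip P" and N: "uniformly_J_negative ip N"
    and sum: "\<And>x. \<exists>p\<in>P. \<exists>n\<in>N. x = p + n"
  obtains Q where "Q \<in> Q_set ip" "\<And>p n. p \<in> P \<Longrightarrow> n \<in> N \<Longrightarrow> Q (p + n) = p"
proof -
  have sP: "csubspace P" and sN: "csubspace N"
    using P N by (simp_all add: uniformly_J_positive_def uniformly_J_negative_def)
  have uniq: "p = p'" if "p \<in> P" "p' \<in> P" "n \<in> N" "n' \<in> N" "p + n = p' + n'" for p p' n n'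
  proof -
    have "p - p' \<in> P" "n' - n \<in> N"
      using that sP sN by (simp_all add: complex_vector.subspace_diff)
    moreover have "p - p' = n' - n" using that(5) by (simp add: algebra_simps)
    ultimately show ?thesis using uniformly_definite_Int[OF P N] by fastforce
  qed
  \<comment> \<open>\<open>Q\<close> starts as an arbitrary choice of \<open>P\<close>-components;
    \<open>uniq\<close> shows that there was only one choice.\<close>
  obtain Q where Q_P: "\<And>x. Q x \<in> P" and "\<And>x. \<exists>n\<in>N. x = Q x + n"
    using sum by metis
  then have Q_N: "x - Q x \<in> N" for x by (metis add_diff_cancel_left')
  have Q: "Q (p + n) = p" if "p \<in> P" "n \<in> N" for p n
    using uniq[OF Q_P that(1) Q_N that(2), of "p + n" "p + n"] by simp
  have Q_fix: "Q p = p" if "p \<in> P" for p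
    using Q[OF that complex_vector.subspace_0[OF sN]] by simp
  obtain K where K: "\<forall>p\<in>P. \<forall>n\<in>N. norm p \<le> K * norm (p + n)"
    using uniformly_definite_summand_bound[OF P N] ..
  have "bounded_clinear Q"
  proof (rule bounded_clinearI)
    show "Q (x + y) = Q x + Q y" for x y
    proof -
      have "Q x + Q y \<in> P" "(x - Q x) + (y - Q y) \<in> N"
        using sP sN Q_P Q_N by (simp_all add: complex_vector.subspace_add)
      from Q[OF this] show ?thesis by simp
    qed
    show "Q (c *\<^sub>C x) = c *\<^sub>C Q x" for c x
    proof -
      have "c *\<^sub>C Q x \<in> P" "c *\<^sub>C (x - Q x) \<in> N"
        using sP sN Q_P Q_N by (simp_all add: complex_vector.subspace_scale)
      from Q[OF this] show ?thesis by (simp flip: scaleC_add_right)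
    qed
    show "norm (Q x) \<le> K * norm x" for x
      using bspec[OF bspec[OF K Q_P[of x]] Q_N[of x]] by simp
  qed
  moreover have "Q \<circ> Q = Q" by (simp add: fun_eq_iff Q_fix[OF Q_P])
  moreover have "range Q = P"
  proof
    show "P \<subseteq> range Q" using Q_fix by (metis rangeI subsetI)
  qed (use Q_P in blast)
  moreover have "{x. Q x = 0} = N"
  proof
    show "{x. Q x = 0} \<subseteq> N"
    proof safe
      fix x assume "Q x = 0"
      then show "x \<in> N" using Q_N[of x] by simp
    qed
    show "N \<subseteq> {x. Q x = 0}"
      using Q[OF complex_vector.subspace_0[OF sP]] by auto
  qed
  ultimately have "Q \<in> Q_set ip" using P N by (simp add: Q_set_def)
  then show thesis using Q by (rule that)
qed

section \<open>The three implications of the cycle\<close>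

lemma J_frame_imp_Q:
  fixes T :: "'i ell2 \<Rightarrow> 'a"
  assumes T: "bounded_clinear T" "surj T" and U: "unitary_operator U"
    and F: "J_frame ip F" and TU: "T \<circ> U = synthesis_operator F"
  shows "\<exists>Q\<in>Q_set ip. Q \<circ> T \<circ> cadjoint T \<circ> cadjoint (\<lambda>x. x - Q x) = (\<lambda>_. 0)"
proof -
  define V where "V = T \<circ> U"
  have bU: "bounded_clinear U" and UU: "U \<circ> cadjoint U = id"
    using U by (simp_all add: unitary_operator_def)
  have bV: "bounded_clinear V" unfolding V_def using T(1) bU by (rule bounded_clinear_compose)
  have "surj U" using UU by (metis comp_apply id_apply surjI)
  then have surj_V: "surj V" unfolding V_def using T(2) by (rule comp_surj)
  define A where "A = {i. Re (ip (F i) (F i)) \<ge> 0}"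
  define P where "P = V ` ell2_on A"
  define N where "N = V ` ell2_on (- A)"
  have A': "- A = {i. Re (ip (F i) (F i)) < 0}" by (auto simp: A_def)
  have P: "uniformly_J_positive ip P" and N: "uniformly_J_negative ip N"
    using F unfolding P_def N_def V_def A' TU
    by (simp_all add: J_frame_def A_def maximal_uniformly_J_positive_def maximal_uniformly_J_negative_def)
  have "\<exists>p\<in>P. \<exists>n\<in>N. x = p + n" for x
  proof -
    obtain z where "x = V z" using surj_V by blast
    moreover obtain a b where "a \<in> ell2_on A" "b \<in> ell2_on (- A)" "z = a + b"
      using ell2_on_split[of A z] by blast
    ultimately show ?thesis unfolding P_def N_def by (auto simp: bounded_clinearD(3)[OF bV])
  qed
  then obtain Q where Q: "Q \<in> Q_set ip" and QPN: "\<And>p n. p \<in> P \<Longrightarrow> n \<in> N \<Longrightarrow> Q (p + n) = p"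
    by (rule Q_set_of_decomposition[OF P N]) blast
  have Q_P: "Q p = p" if "p \<in> P" for p
    using QPN[OF that, of 0] N by (simp add: uniformly_J_negative_def complex_vector.subspace_0)
  have Q_N: "Q n = 0" if "n \<in> N" for n
    using QPN[OF _ that, of 0] P by (simp add: uniformly_J_positive_def complex_vector.subspace_0)
  have bQ: "bounded_clinear Q" using Q by (simp add: Q_set_def)
  \<comment> \<open>\<open>U\<close> cancels against its adjoint, so \<open>V\<close> and
    \<open>T\<close> have the same frame operator.\<close>
  have VV: "V (cadjoint V y) = T (cadjoint T y)" for y
    unfolding V_def cadjoint_compose[OF T(1) bU] using fun_cong[OF UU] by simp
  have "Q (T (cadjoint T (cadjoint (\<lambda>x. x - Q x) y))) = 0" for y
  proof -
    \<comment> \<open>The coordinate at \<open>i\<close> is the inner product of \<open>y\<close>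
      with \<open>V (ell2_basis i)\<close> minus its image under \<open>Q\<close>; for
      \<open>i\<close> in \<open>A\<close> that vector lies in \<open>P\<close>, which
      \<open>Q\<close> fixes.\<close>
    have "cadjoint V (cadjoint (\<lambda>x. x - Q x) y) \<in> ell2_on (- A)"
      unfolding ell2_on_def
    proof (intro CollectI allI impI)
      fix i assume "i \<notin> - A"
      then have "i \<in> A" by simp
      then have "V (ell2_basis i) \<in> P" unfolding P_def by (intro imageI ell2_basis_in_ell2_on)
      then show "ell2_coord (cadjoint V (cadjoint (\<lambda>x. x - Q x) y)) i = 0"
        by (simp add: ell2_coord_eq_cinner cinner_cadjoint_left bV bounded_clinear_id_minus[OF bQ] Q_P)
    qed
    then show ?thesis unfolding VV[symmetric] by (intro Q_N) (simp add: N_def)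
  qed
  then show ?thesis using Q by (intro bexI[of _ Q]) (auto simp: fun_eq_iff)
qed

lemma Q_imp_splitting:
  fixes T :: "'i ell2 \<Rightarrow> 'a"
  assumes T: "bounded_clinear T" "surj T" and Q: "Q \<in> Q_set ip"
    and zero: "Q \<circ> T \<circ> cadjoint T \<circ> cadjoint (\<lambda>x. x - Q x) = (\<lambda>_. 0)"
  shows "\<exists>T1 T2 :: 'i ell2 \<Rightarrow> 'a. bounded_clinear T1 \<and> bounded_clinear T2
            \<and> closed (range T1) \<and> closed (range T2)
            \<and> T = (\<lambda>x. T1 x + T2 x)
            \<and> uniformly_J_positive ip (range T1) \<and> uniformly_J_negative ip (range T2)
            \<and> T1 \<circ> cadjoint T2 = (\<lambda>_. 0) \<and> T2 \<circ> cadjoint T1 = (\<lambda>_. 0)"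
proof -
  have bQ: "bounded_clinear Q" and QQ: "Q (Q x) = Q x" for x
    using Q by (auto simp: Q_set_def fun_eq_iff)
  have P: "uniformly_J_positive ip (range Q)" and N: "uniformly_J_negative ip {x. Q x = 0}"
    using Q by (simp_all add: Q_set_def)
  have bQ': "bounded_clinear (\<lambda>x. x - Q x)" by (rule bounded_clinear_id_minus[OF bQ])
  define T1 where "T1 = Q \<circ> T"
  define T2 where "T2 = (\<lambda>x. x - Q x) \<circ> T"
  have b1: "bounded_clinear T1" and b2: "bounded_clinear T2"
    unfolding T1_def T2_def using bQ bQ' T(1) by (simp_all add: bounded_clinear_compose)
  have T12: "T1 (cadjoint T2 y) = 0" for y
    using fun_cong[OF zero, of y] by (simp add: T1_def T2_def cadjoint_compose[OF bQ' T(1)])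
  \<comment> \<open>The adjoint of the previous identity.\<close>
  have T21: "T2 (cadjoint T1 y) = 0" for y
  proof (rule cinner_eqI)
    fix z
    show "cinner z (T2 (cadjoint T1 y)) = cinner z 0"
      by (simp add: cinner_cadjoint_left[OF b2, symmetric] cinner_cadjoint_right[OF b1] T12)
  qed
  \<comment> \<open>Surjectivity of \<open>T\<close> identifies the ranges with those of
    \<open>Q\<close> and its complementary projection. Each of these is the kernel of the other
    projection, hence closed.\<close>
  have "range T1 = range Q" unfolding T1_def image_comp[symmetric] T(2) ..
  moreover have "range Q = {x. x - Q x = 0}"
    by (auto simp: QQ intro: range_eqI)
  moreover have "range T2 = {x. Q x = 0}"
  proof -
    have "range T2 = range (\<lambda>x. x - Q x)" unfolding T2_def image_comp[symmetric] T(2) ..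
    moreover have "x \<in> range (\<lambda>x. x - Q x)" if "Q x = 0" for x
      using that by (intro range_eqI[of _ _ x]) simp
    ultimately show ?thesis by (auto simp: bounded_clinearD(4)[OF bQ] QQ)
  qed
  ultimately have "closed (range T1)" "closed (range T2)"
    "uniformly_J_positive ip (range T1)" "uniformly_J_negative ip (range T2)"
    using closed_kernel[OF bQ'] closed_kernel[OF bQ] P N by simp_all
  moreover have "T = (\<lambda>x. T1 x + T2 x)" by (simp add: T1_def T2_def)
  ultimately show ?thesis
    using b1 b2 T12 T21 by (intro exI[of _ T1] exI[of _ T2]) (simp add: comp_def)
qed

lemma splitting_imp_J_frame:
  fixes T T1 T2 :: "'i ell2 \<Rightarrow> 'a"
  assumes T: "bounded_clinear T" "surj T" and T_sum: "\<And>x. T x = T1 x + T2 x"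
    and b1: "bounded_clinear T1" and b2: "bounded_clinear T2"
    and P: "uniformly_J_positive ip (range T1)" and N: "uniformly_J_negative ip (range T2)"
    and T21: "\<And>y. T2 (cadjoint T1 y) = 0"
  shows "\<exists>U F. unitary_operator U \<and> J_frame ip F \<and> T \<circ> U = synthesis_operator F"
proof -
  let ?S = "{x. T2 x = 0}"
  obtain B where B: "total_orthonormal B" and
    B_cases: "\<And>b. b \<in> B \<Longrightarrow> b \<in> ?S \<or> (\<forall>s\<in>?S. cinner s b = 0)"
    by (rule total_orthonormal_within_closed_subspace[OF csubspace_kernel[OF b2] closed_kernel[OF b2]]) blast
  obtain \<phi> where \<phi>: "bij_betw \<phi> (UNIV :: 'i set) B"
    by (rule total_orthonormal_enumeration[OF B])
  obtain U where U: "unitary_operator U" and U_basis: "\<And>i. U (ell2_basis i) = \<phi> i"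
    by (rule unitary_from_enumeration[OF B \<phi>]) blast
  have bU: "bounded_clinear U" and UU: "U \<circ> cadjoint U = id"
    using U by (simp_all add: unitary_operator_def)
  have "surj U" using UU by (metis comp_apply id_apply surjI)
  define V where "V = T \<circ> U"
  define F where "F = (\<lambda>i. V (ell2_basis i))"
  have bV: "bounded_clinear V" unfolding V_def using T(1) bU by (rule bounded_clinear_compose)
  have surj_V: "surj V" unfolding V_def using \<open>surj U\<close> T(2) by (rule comp_surj)
  have syn: "synthesis_operator F = V" by (rule synthesis_operator_eqI[OF bV]) (simp add: F_def)
  define A where "A = {i. Re (ip (F i) (F i)) \<ge> 0}"
  have A': "- A = {i. Re (ip (F i) (F i)) < 0}" by (auto simp: A_def)
  obtain \<alpha> where "\<alpha> > 0" and \<alpha>: "\<And>x. \<alpha> * (norm (T1 x))\<^sup>2 \<le> Re (ip (T1 x) (T1 x))"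
    using P unfolding uniformly_J_positive_def by blast
  obtain \<beta> where "\<beta> > 0" and \<beta>: "\<And>x. Re (ip (T2 x) (T2 x)) \<le> - \<beta> * (norm (T2 x))\<^sup>2"
    using N unfolding uniformly_J_negative_def by blast
  \<comment> \<open>The sign of \<open>F i\<close> detects the half of the basis containing
    \<open>\<phi> i\<close>. A vanishing \<open>F i\<close> belongs to \<open>A\<close>,
    consistently with \<open>T2 (\<phi> i) = 0\<close>.\<close>
  have key: "if i \<in> A then T2 (\<phi> i) = 0 else T1 (\<phi> i) = 0" for i
  proof -
    have "\<phi> i \<in> B" using \<phi> by (simp add: bij_betw_apply)
    have Fi: "F i = T1 (\<phi> i) + T2 (\<phi> i)" by (simp add: F_def V_def U_basis T_sum)
    show ?thesis
    proof (cases "T2 (\<phi> i) = 0")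
      case True
      then have "\<alpha> * (norm (F i))\<^sup>2 \<le> Re (ip (F i) (F i))" using \<alpha>[of "\<phi> i"] Fi by simp
      moreover have "0 \<le> \<alpha> * (norm (F i))\<^sup>2" using \<open>\<alpha> > 0\<close> by simp
      ultimately have "i \<in> A" unfolding A_def by simp
      then show ?thesis using True by simp
    next
      case False
      then have o: "cinner s (\<phi> i) = 0" if "T2 s = 0" for s
        using B_cases[OF \<open>\<phi> i \<in> B\<close>] that by blast
      \<comment> \<open>The range of \<open>cadjoint T1\<close> lies in the kernel of
        \<open>T2\<close>, to which \<open>\<phi> i\<close> is orthogonal.\<close>
      have T1\<phi>: "T1 (\<phi> i) = 0"
      proof (rule cinner_eqI)
        fix z
        show "cinner z (T1 (\<phi> i)) = cinner z 0"
          using o[OF T21[of z]] by (simp add: cinner_cadjoint_left[OF b1])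
      qed
      then have "Re (ip (F i) (F i)) \<le> - \<beta> * (norm (F i))\<^sup>2" using \<beta>[of "\<phi> i"] Fi by simp
      \<comment> \<open>Strictness holds because \<open>F i\<close> equals the nonzero vector
        \<open>T2 (\<phi> i)\<close>.\<close>
      moreover have "0 < \<beta> * (norm (F i))\<^sup>2" using \<open>\<beta> > 0\<close> Fi T1\<phi> False by simp
      ultimately have "i \<notin> A" unfolding A_def by simp
      then show ?thesis using T1\<phi> by simp
    qed
  qed
  \<comment> \<open>On \<open>ell2_on A\<close> the summand \<open>T2\<close> contributes nothing,
    so \<open>V\<close> acts there as \<open>T1\<close> after \<open>U\<close>.\<close>
  have V_pos: "V x \<in> range T1" if "x \<in> ell2_on A" for x
  proof -
    have "(T2 \<circ> U) x = 0"
      using bounded_clinear_compose[OF b2 bU] _ that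
    proof (rule bounded_clinear_vanishes_on_ell2_on)
      show "(T2 \<circ> U) (ell2_basis i) = 0" if "i \<in> A" for i
        using key[of i] that by (simp add: U_basis)
    qed
    then show ?thesis by (simp add: V_def T_sum)
  qed
  have V_neg: "V x \<in> range T2" if "x \<in> ell2_on (- A)" for x
  proof -
    have "(T1 \<circ> U) x = 0"
      using bounded_clinear_compose[OF b1 bU] _ that
    proof (rule bounded_clinear_vanishes_on_ell2_on)
      show "(T1 \<circ> U) (ell2_basis i) = 0" if "i \<in> - A" for i
        using key[of i] that by (simp add: U_basis)
    qed
    then show ?thesis by (simp add: V_def T_sum)
  qed
  have s1: "csubspace (range T1)" and s2: "csubspace (range T2)"
    using b1 b2 by (simp_all add: csubspace_range)
  have split: "\<exists>a b. a \<in> ell2_on A \<and> b \<in> ell2_on (- A) \<and> y = V a + V b" for y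
  proof -
    obtain z where z: "y = V z" using surj_V by blast
    obtain a b where "a \<in> ell2_on A" "b \<in> ell2_on (- A)" "z = a + b"
      using ell2_on_split[of A z] by blast
    then show ?thesis using z bounded_clinearD(3)[OF bV] by metis
  qed
  have "V ` ell2_on A = range T1"
  proof
    show "range T1 \<subseteq> V ` ell2_on A"
    proof
      fix y assume y: "y \<in> range T1"
      obtain a b where ab: "a \<in> ell2_on A" "b \<in> ell2_on (- A)" "y = V a + V b"
        using split by blast
      \<comment> \<open>This difference is \<open>V b\<close>, which is therefore in both ranges and
        vanishes by definiteness.\<close>
      have "y - V a \<in> range T1" using s1 y V_pos[OF ab(1)] by (rule complex_vector.subspace_diff)
      then have "V b = 0" using uniformly_definite_Int[OF P N _ V_neg[OF ab(2)]] ab(3) by simp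
      then show "y \<in> V ` ell2_on A" using ab by simp
    qed
  qed (use V_pos in blast)
  moreover have "V ` ell2_on (- A) = range T2"
  proof
    show "range T2 \<subseteq> V ` ell2_on (- A)"
    proof
      fix y assume y: "y \<in> range T2"
      obtain a b where ab: "a \<in> ell2_on A" "b \<in> ell2_on (- A)" "y = V a + V b"
        using split by blast
      have "y - V b \<in> range T2" using s2 y V_neg[OF ab(2)] by (rule complex_vector.subspace_diff)
      then have "V a = 0" using uniformly_definite_Int[OF P N V_pos[OF ab(1)]] ab(3) by simp
      then show "y \<in> V ` ell2_on (- A)" using ab by simp
    qed
  qed (use V_neg in blast)
  \<comment> \<open>The two ranges fill the space, which is what
    \<open>maximal_of_complement\<close> needs for maximality.\<close>
  moreover have "\<exists>p\<in>range T1. \<exists>n\<in>range T2. x = p + n" for x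
    using T(2) T_sum by (metis rangeI surjD)
  ultimately have "J_frame ip F"
    unfolding J_frame_def syn A'[symmetric] A_def[symmetric]
    using maximal_of_complement[OF P N] bessel_family_image_ell2_basis[OF bV]
    by (simp add: F_def)
  then show ?thesis using U syn V_def by metis
qed

end

theorem theorem4p3:
  fixes ip :: "'a::chilbert_space \<Rightarrow> 'a \<Rightarrow> complex"
    and Hp Hm :: "'a set"
    and T :: "'i ell2 \<Rightarrow> 'a"
  assumes "krein_space ip Hp Hm"
    and "bounded_clinear T" and "surj T"
  shows "((\<exists>U F. unitary_operator U \<and> J_frame ip F \<and> T \<circ> U = synthesis_operator F)
      \<longleftrightarrow> (\<exists>Q\<in>Q_set ip. Q \<circ> T \<circ> cadjoint T \<circ> cadjoint (\<lambda>x. x - Q x) = (\<lambda>_. 0)))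
    \<and> ((\<exists>Q\<in>Q_set ip. Q \<circ> T \<circ> cadjoint T \<circ> cadjoint (\<lambda>x. x - Q x) = (\<lambda>_. 0))
      \<longleftrightarrow> (\<exists>T1 T2 :: 'i ell2 \<Rightarrow> 'a. bounded_clinear T1 \<and> bounded_clinear T2
            \<and> closed (range T1) \<and> closed (range T2)
            \<and> T = (\<lambda>x. T1 x + T2 x)
            \<and> uniformly_J_positive ip (range T1) \<and> uniformly_J_negative ip (range T2)
            \<and> T1 \<circ> cadjoint T2 = (\<lambda>_. 0) \<and> T2 \<circ> cadjoint T1 = (\<lambda>_. 0)))"
proof -
  interpret krein_space ip Hp Hm by fact
  note T = assms(2,3)
  let ?J = "\<exists>U F. unitary_operator U \<and> J_frame ip F \<and> T \<circ> U = synthesis_operator F"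
  let ?Q = "\<exists>Q\<in>Q_set ip. Q \<circ> T \<circ> cadjoint T \<circ> cadjoint (\<lambda>x. x - Q x) = (\<lambda>_. 0)"
  let ?S = "\<exists>T1 T2 :: 'i ell2 \<Rightarrow> 'a. bounded_clinear T1 \<and> bounded_clinear T2
            \<and> closed (range T1) \<and> closed (range T2)
            \<and> T = (\<lambda>x. T1 x + T2 x)
            \<and> uniformly_J_positive ip (range T1) \<and> uniformly_J_negative ip (range T2)
            \<and> T1 \<circ> cadjoint T2 = (\<lambda>_. 0) \<and> T2 \<circ> cadjoint T1 = (\<lambda>_. 0)"
  have "?J \<Longrightarrow> ?Q" using J_frame_imp_Q[OF T] by blast
  moreover have "?Q \<Longrightarrow> ?S" using Q_imp_splitting[OF T] by blast
  moreover have "?S \<Longrightarrow> ?J"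
  proof (elim exE conjE)
    fix T1 T2 :: "'i ell2 \<Rightarrow> 'a"
    assume "T = (\<lambda>x. T1 x + T2 x)" "T2 \<circ> cadjoint T1 = (\<lambda>_. 0)"
      and h: "bounded_clinear T1" "bounded_clinear T2"
        "uniformly_J_positive ip (range T1)" "uniformly_J_negative ip (range T2)"
    then have "\<And>x. T x = T1 x + T2 x" "\<And>y. T2 (cadjoint T1 y) = 0"
      by (simp_all add: fun_eq_iff)
    then show ?J using T h splitting_imp_J_frame by blast
  qed
  ultimately show ?thesis by blast
qed

end
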